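(* Let $\Gamma$ be any countable (undirected) graph. There are $2^{\aleph_0}$ non-regular $\mathscr{D}$-classes of the endomorphism monoid of the countable universal directed graph $D$ such that the Schützenberger groups of $\mathscr{H}$-classes within them are isomorphic to $\operatorname{Aut}\Gamma$.
   Context: A graph is a pair $(V,E)$ with $E$ an irreflexive symmetric binary relation on $V$; a directed graph is a pair $(V,E)$ with $E$ an irreflexive binary relation on $V$. The countable universal directed graph $D$ is the Fraïssé limit of the finite directed graphs. $\operatorname{End} D$ is its endomorphism monoid, maps on the right. Green's relations on a monoid $M$: $f\,\mathscr{L}\,g$ iff $Mf=Mg$; $f\,\mathscr{R}\,g$ iff $fM=gM$; $\mathscr{H}=\mathscr{L}\cap\mathscr{R}$; $\mathscr{D}=\mathscr{L}\circ\mathscr{R}$. An element $f$ is regular if $fgf=f$ for some $g\in M$; a $\mathscr{D}$-class is non-regular if its elements are not regular. For an $\mathscr{H}$-class $H$, let $T_H=\{t\in M: Ht\subseteq H\}$ and $\gamma_t:H\to H$, $h\mapsto ht$; the Schützenberger group of $H$ is $\{\gamma_t:t\in T_H\}$. *)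

theory Defs
  imports "HOL-Algebra.Coset" "HOL-Library.Equipollence" "HOL-Library.Countable_Set"
    "HOL-Library.Nat_Bijection"
begin

section \<open>Directed and undirected graphs\<close>

definition is_digraph :: "'a set \<Rightarrow> 'a rel \<Rightarrow> bool" where
  "is_digraph V E \<longleftrightarrow> E \<subseteq> V \<times> V \<and> irrefl E"

definition is_graph :: "'a set \<Rightarrow> 'a rel \<Rightarrow> bool" where
  "is_graph V E \<longleftrightarrow> is_digraph V E \<and> sym E"

text \<open>
  Only the values of \<^term>\<open>f\<close> on \<^term>\<open>A\<close> and the edges inside \<^term>\<open>A\<close> and \<^term>\<open>B\<close> matter.
  For \<^term>\<open>A\<close>, \<^term>\<open>B\<close> contained in the vertex set of a digraph with edge relation \<^term>\<open>E\<close>,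
  \<^term>\<open>digraph_iso A E B E f\<close> therefore says that \<^term>\<open>f\<close> is an isomorphism between the
  induced subdigraphs on \<^term>\<open>A\<close> and \<^term>\<open>B\<close>.\<close>

definition digraph_iso ::
    "'a set \<Rightarrow> 'a rel \<Rightarrow> 'b set \<Rightarrow> 'b rel \<Rightarrow> ('a \<Rightarrow> 'b) \<Rightarrow> bool" where
  "digraph_iso A E B F f \<longleftrightarrow>
     bij_betw f A B \<and> (\<forall>x\<in>A. \<forall>y\<in>A. (x, y) \<in> E \<longleftrightarrow> (f x, f y) \<in> F)"

section \<open>The countable universal directed graph\<close>

definition ultrahomogeneous :: "'a set \<Rightarrow> 'a rel \<Rightarrow> bool" where
  "ultrahomogeneous V E \<longleftrightarrow>
     (\<forall>A B f. finite A \<and> A \<subseteq> V \<and> B \<subseteq> V \<and> digraph_iso A E B E f \<longrightarrow>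
        (\<exists>g. digraph_iso V E V E g \<and> (\<forall>x\<in>A. g x = f x)))"

text \<open>Since the age is closed under isomorphism, it is represented by its members on sets of
  natural numbers.\<close>

definition age :: "'a set \<Rightarrow> 'a rel \<Rightarrow> (nat set \<times> nat rel) set" where
  "age V E = {(W, F). finite W \<and> F \<subseteq> W \<times> W \<and> (\<exists>A f. A \<subseteq> V \<and> digraph_iso W F A E f)}"

text \<open>The Fraisse limit of a class of finite structures is the countable ultrahomogeneous
  structure with that class as its age; it is determined up to isomorphism.\<close>

definition universal_digraph :: "'a set \<Rightarrow> 'a rel \<Rightarrow> bool" where
  "universal_digraph V E \<longleftrightarrow>
     is_digraph V E \<and> countable V \<and> ultrahomogeneous V E \<and>
     age V E = {(W, F). finite W \<and> is_digraph W F}"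

section \<open>Endomorphism monoids and automorphism groups\<close>

text \<open>Maps act on the right: the product of \<^term>\<open>f\<close> and \<^term>\<open>g\<close> is \<^term>\<open>f\<close> followed by
  \<^term>\<open>g\<close>, that is, \<^term>\<open>compose V g f\<close>.\<close>

definition End_monoid :: "'a set \<Rightarrow> 'a rel \<Rightarrow> ('a \<Rightarrow> 'a) monoid" where
  "End_monoid V E =
     \<lparr>carrier = {f \<in> V \<rightarrow>\<^sub>E V. \<forall>x y. (x, y) \<in> E \<longrightarrow> (f x, f y) \<in> E},
      mult = (\<lambda>f g. compose V g f),
      one = (\<lambda>x\<in>V. x)\<rparr>"

definition Aut_group :: "'a set \<Rightarrow> 'a rel \<Rightarrow> ('a \<Rightarrow> 'a) monoid" where
  "Aut_group V E =
     \<lparr>carrier = {f \<in> V \<rightarrow>\<^sub>E V. digraph_iso V E V E f},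
      mult = (\<lambda>f g. compose V g f),
      one = (\<lambda>x\<in>V. x)\<rparr>"

section \<open>Green's relations and Schuetzenberger groups\<close>

definition green_L :: "('m, 'b) monoid_scheme \<Rightarrow> 'm rel" where
  "green_L M = {(f, g). f \<in> carrier M \<and> g \<in> carrier M \<and>
     carrier M #>\<^bsub>M\<^esub> f = carrier M #>\<^bsub>M\<^esub> g}"

definition green_R :: "('m, 'b) monoid_scheme \<Rightarrow> 'm rel" where
  "green_R M = {(f, g). f \<in> carrier M \<and> g \<in> carrier M \<and>
     f <#\<^bsub>M\<^esub> carrier M = g <#\<^bsub>M\<^esub> carrier M}"

definition green_H :: "('m, 'b) monoid_scheme \<Rightarrow> 'm rel" where
  "green_H M = green_L M \<inter> green_R M"

definition green_D :: "('m, 'b) monoid_scheme \<Rightarrow> 'm rel" where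
  "green_D M = green_L M O green_R M"

definition regular_element :: "('m, 'b) monoid_scheme \<Rightarrow> 'm \<Rightarrow> bool" where
  "regular_element M f \<longleftrightarrow> (\<exists>g\<in>carrier M. f \<otimes>\<^bsub>M\<^esub> g \<otimes>\<^bsub>M\<^esub> f = f)"

definition nonregular_class :: "('m, 'b) monoid_scheme \<Rightarrow> 'm set \<Rightarrow> bool" where
  "nonregular_class M C \<longleftrightarrow> (\<forall>f\<in>C. \<not> regular_element M f)"

definition right_stabiliser :: "('m, 'b) monoid_scheme \<Rightarrow> 'm set \<Rightarrow> 'm set" where
  "right_stabiliser M H = {t \<in> carrier M. H #>\<^bsub>M\<^esub> t \<subseteq> H}"

definition right_translation :: "('m, 'b) monoid_scheme \<Rightarrow> 'm set \<Rightarrow> 'm \<Rightarrow> 'm \<Rightarrow> 'm" where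
  "right_translation M H t = (\<lambda>h\<in>H. h \<otimes>\<^bsub>M\<^esub> t)"

definition schuetzenberger_group :: "('m, 'b) monoid_scheme \<Rightarrow> 'm set \<Rightarrow> ('m \<Rightarrow> 'm) monoid" where
  "schuetzenberger_group M H =
     \<lparr>carrier = right_translation M H ` right_stabiliser M H,
      mult = (\<lambda>a b. compose H b a),
      one = (\<lambda>h\<in>H. h)\<rparr>"

section \<open>Existence of the countable universal directed graph\<close>

definition code_digraph :: "nat rel" where
  "code_digraph = {(i, j). (j < i \<and> 2 * j \<in> set_decode i) \<or> (i < j \<and> 2 * i + 1 \<in> set_decode j)}"

lemma code_digraph_extension:
  assumes "finite A"
  obtains z where "z \<notin> A"
    "\<And>a. a \<in> A \<Longrightarrow> (z, a) \<in> code_digraph \<longleftrightarrow> a \<in> S"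
    "\<And>a. a \<in> A \<Longrightarrow> (a, z) \<in> code_digraph \<longleftrightarrow> a \<in> T"
proof -
  obtain N where N: "\<And>a. a \<in> A \<Longrightarrow> a < N"
    using assms unfolding finite_nat_set_iff_bounded by blast
  define X where "X = (\<lambda>a. 2 * a) ` (A \<inter> S) \<union> (\<lambda>a. 2 * a + 1) ` (A \<inter> T) \<union> {2 * N}"
  define z where "z = set_encode X"
  have fin: "finite X" using assms by (simp add: X_def)
  have dec: "set_decode z = X" using fin by (simp add: z_def)
  have "(2::nat) ^ (2 * N) \<le> z"
    unfolding z_def set_encode_def using fin by (intro member_le_sum) (auto simp: X_def)
  moreover have "N < (2::nat) ^ (2 * N)"
    using less_exp[of "2 * N"] by linarith
  ultimately have "N < z" by (rule order.strict_trans2[rotated])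
  then have lt: "a < z" if "a \<in> A" for a using N[OF that] by simp
  show thesis
  proof
    show "z \<notin> A" using lt by blast
    fix a assume a: "a \<in> A"
    have parity: "2 * a \<noteq> 2 * b + 1" "2 * a + 1 \<noteq> 2 * b" for b :: nat by presburger+
    have "2 * a \<in> X \<longleftrightarrow> a \<in> S"
      unfolding X_def using a N[OF a] parity by fastforce
    then show "(z, a) \<in> code_digraph \<longleftrightarrow> a \<in> S"
      unfolding code_digraph_def mem_Collect_eq prod.case dec using lt[OF a] by simp
    have "2 * a + 1 \<in> X \<longleftrightarrow> a \<in> T"
      unfolding X_def using a N[OF a] parity by fastforce
    then show "(a, z) \<in> code_digraph \<longleftrightarrow> a \<in> T"
      unfolding code_digraph_def mem_Collect_eq prod.case dec using lt[OF a] by simp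
  qed
qed

lemma irrefl_code_digraph: "(x, x) \<notin> code_digraph"
  by (simp add: code_digraph_def)

definition partial_code_iso :: "nat rel \<Rightarrow> bool" where
  "partial_code_iso p \<longleftrightarrow> (\<forall>a b c d. (a, b) \<in> p \<longrightarrow> (c, d) \<in> p \<longrightarrow>
     (a = c \<longleftrightarrow> b = d) \<and> ((a, c) \<in> code_digraph \<longleftrightarrow> (b, d) \<in> code_digraph))"

lemma partial_code_iso_forth:
  assumes p: "partial_code_iso p" "finite p"
  obtains q where "p \<subseteq> q" "partial_code_iso q" "finite q" "x \<in> Domain q"
proof (cases "x \<in> Domain p")
  case True
  then show thesis using that p by blast
next
  case False
  obtain z where z: "z \<notin> Range p"
    "\<And>b. b \<in> Range p \<Longrightarrow> (z, b) \<in> code_digraph \<longleftrightarrow> b \<in> {b. \<exists>a. (a, b) \<in> p \<and> (x, a) \<in> code_digraph}"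
    "\<And>b. b \<in> Range p \<Longrightarrow> (b, z) \<in> code_digraph \<longleftrightarrow> b \<in> {b. \<exists>a. (a, b) \<in> p \<and> (a, x) \<in> code_digraph}"
    using code_digraph_extension[OF finite_Range[OF p(2)],
        where S = "{b. \<exists>a. (a, b) \<in> p \<and> (x, a) \<in> code_digraph}"
          and T = "{b. \<exists>a. (a, b) \<in> p \<and> (a, x) \<in> code_digraph}"] by blast
  have new: "a \<noteq> x \<and> b \<noteq> z \<and> ((z, b) \<in> code_digraph \<longleftrightarrow> (x, a) \<in> code_digraph) \<and>
      ((b, z) \<in> code_digraph \<longleftrightarrow> (a, x) \<in> code_digraph)" if ab: "(a, b) \<in> p" for a b
  proof -
    have "a' = a" if "(a', b) \<in> p" for a' using p(1) that ab by (auto simp: partial_code_iso_def)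
    moreover have "b \<in> Range p" using ab by blast
    ultimately show ?thesis using z False ab by blast
  qed
  have "partial_code_iso (insert (x, z) p)"
    unfolding partial_code_iso_def
  proof (intro allI impI)
    fix a b c d assume h: "(a, b) \<in> insert (x, z) p" "(c, d) \<in> insert (x, z) p"
    consider "(a, b) \<in> p" "(c, d) \<in> p" | "(a, b) \<in> p" "c = x" "d = z"
      | "a = x" "b = z" "(c, d) \<in> p" | "a = x" "b = z" "c = x" "d = z" using h by auto
    then show "(a = c \<longleftrightarrow> b = d) \<and> ((a, c) \<in> code_digraph \<longleftrightarrow> (b, d) \<in> code_digraph)"
    proof cases
      case 1 then show ?thesis using p(1) unfolding partial_code_iso_def by blast
    next
      case 2 then show ?thesis using new by blast
    next
      case 3 then show ?thesis using new by blast
    next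
      case 4 then show ?thesis by (simp add: irrefl_code_digraph)
    qed
  qed
  then show thesis using that[of "insert (x, z) p"] p(2) by blast
qed

lemma partial_code_iso_step:
  assumes p: "partial_code_iso p" "finite p"
  shows "\<exists>q. p \<subseteq> q \<and> partial_code_iso q \<and> finite q \<and> x \<in> Domain q \<and> x \<in> Range q"
proof -
  obtain q where q: "p \<subseteq> q" "partial_code_iso q" "finite q" "x \<in> Domain q"
    using partial_code_iso_forth[OF p] by metis
  have "partial_code_iso (q\<inverse>)" using q(2) unfolding partial_code_iso_def by blast
  then obtain r where r: "q\<inverse> \<subseteq> r" "partial_code_iso r" "finite r" "x \<in> Domain r"
    using partial_code_iso_forth[of "q\<inverse>"] q(3) by (metis finite_converse)
  have "partial_code_iso (r\<inverse>)" using r(2) unfolding partial_code_iso_def by blast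
  moreover have "p \<subseteq> r\<inverse>" "x \<in> Domain (r\<inverse>)" "x \<in> Range (r\<inverse>)" "finite (r\<inverse>)"
    using q r by auto
  ultimately show ?thesis by blast
qed

lemma ultrahomogeneous_code_digraph: "ultrahomogeneous UNIV code_digraph"
  unfolding ultrahomogeneous_def
proof (intro allI impI, elim conjE)
  fix A B :: "nat set" and f
  assume A: "finite A" and f: "digraph_iso A code_digraph B code_digraph f"
  define p where "p = (\<lambda>a. (a, f a)) ` A"
  have p: "partial_code_iso p" "finite p"
    using A f by (auto simp: p_def partial_code_iso_def digraph_iso_def bij_betw_def inj_on_def)
  have "\<exists>s. \<forall>n. (partial_code_iso (s n) \<and> finite (s n) \<and> p \<subseteq> s n) \<and>
      (s n \<subseteq> s (Suc n) \<and> n \<in> Domain (s (Suc n)) \<and> n \<in> Range (s (Suc n)))"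
  proof (rule dependent_nat_choice)
    show "\<exists>q. partial_code_iso q \<and> finite q \<and> p \<subseteq> q" using p by blast
    show "\<exists>r. (partial_code_iso r \<and> finite r \<and> p \<subseteq> r) \<and> q \<subseteq> r \<and> n \<in> Domain r \<and> n \<in> Range r"
      if "partial_code_iso q \<and> finite q \<and> p \<subseteq> q" for q n
      using partial_code_iso_step[of q n] that by (meson order_trans)
  qed
  then obtain s where s: "\<And>n. partial_code_iso (s n)" "\<And>n. p \<subseteq> s n" "\<And>n. s n \<subseteq> s (Suc n)"
    "\<And>n. n \<in> Domain (s (Suc n))" "\<And>n. n \<in> Range (s (Suc n))" by blast
  define U where "U = (\<Union>n. s n)"
  have mono: "s m \<subseteq> s n" if "m \<le> n" for m n using lift_Suc_mono_le[of s, OF s(3) that] .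
  have U: "partial_code_iso U"
    unfolding partial_code_iso_def
  proof (intro allI impI)
    fix a b c d assume "(a, b) \<in> U" "(c, d) \<in> U"
    then obtain m n where "(a, b) \<in> s m" "(c, d) \<in> s n" by (auto simp: U_def)
    then have "(a, b) \<in> s (max m n)" "(c, d) \<in> s (max m n)"
      using mono[of m "max m n"] mono[of n "max m n"] by auto
    then show "(a = c \<longleftrightarrow> b = d) \<and> ((a, c) \<in> code_digraph \<longleftrightarrow> (b, d) \<in> code_digraph)"
      using s(1)[of "max m n"] unfolding partial_code_iso_def by blast
  qed
  have "\<forall>x. \<exists>y. (x, y) \<in> U" using s(4) by (auto simp: U_def) blast
  then obtain g where g: "\<And>x. (x, g x) \<in> U" by metis
  have surj: "\<exists>x. g x = y" for y
  proof -
    obtain x where "(x, y) \<in> U" using s(5)[of y] by (auto simp: U_def)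
    then show ?thesis using U g[of x] unfolding partial_code_iso_def by metis
  qed
  have "digraph_iso UNIV code_digraph UNIV code_digraph g"
    unfolding digraph_iso_def bij_betw_def
  proof (intro conjI ballI)
    show "inj g" using U g unfolding partial_code_iso_def inj_def by metis
    show "range g = UNIV" using surj by (metis surj_def)
    show "(x, y) \<in> code_digraph \<longleftrightarrow> (g x, g y) \<in> code_digraph" for x y
      using U g unfolding partial_code_iso_def by blast
  qed
  moreover have "g x = f x" if "x \<in> A" for x
  proof -
    have "(x, f x) \<in> U" using that s(2)[of 0] by (auto simp: U_def p_def)
    then show ?thesis using U g[of x] unfolding partial_code_iso_def by metis
  qed
  ultimately show "\<exists>g. digraph_iso UNIV code_digraph UNIV code_digraph g \<and> (\<forall>x\<in>A. g x = f x)"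
    by (intro exI[of _ g]) simp
qed

lemma finite_digraph_embeds_code_digraph:
  assumes "finite W" "irrefl F"
  shows "\<exists>f. inj_on f W \<and> (\<forall>x\<in>W. \<forall>y\<in>W. (x, y) \<in> F \<longleftrightarrow> (f x, f y) \<in> code_digraph)"
  using assms(1)
proof (induction W rule: finite_induct)
  case empty
  then show ?case by simp
next
  case (insert x W)
  then obtain f where f: "inj_on f W"
    "\<And>u v. u \<in> W \<Longrightarrow> v \<in> W \<Longrightarrow> (u, v) \<in> F \<longleftrightarrow> (f u, f v) \<in> code_digraph" by blast
  obtain z where z: "z \<notin> f ` W"
    "\<And>b. b \<in> f ` W \<Longrightarrow> (z, b) \<in> code_digraph \<longleftrightarrow> b \<in> f ` {w \<in> W. (x, w) \<in> F}"
    "\<And>b. b \<in> f ` W \<Longrightarrow> (b, z) \<in> code_digraph \<longleftrightarrow> b \<in> f ` {w \<in> W. (w, x) \<in> F}"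
    using code_digraph_extension[OF finite_imageI[OF insert.hyps(1)],
        where S = "f ` {w \<in> W. (x, w) \<in> F}" and T = "f ` {w \<in> W. (w, x) \<in> F}"] by blast
  have new: "((z, f w) \<in> code_digraph \<longleftrightarrow> (x, w) \<in> F) \<and> ((f w, z) \<in> code_digraph \<longleftrightarrow> (w, x) \<in> F)"
    if w: "w \<in> W" for w
  proof -
    have "f w \<in> f ` {w \<in> W. P w} \<longleftrightarrow> P w" for P
      using inj_on_image_mem_iff[OF f(1) w, of "{w \<in> W. P w}"] w by auto
    then show ?thesis using z(2,3)[of "f w"] w by simp
  qed
  have ne: "w \<noteq> x" if "w \<in> W" for w using that insert.hyps by blast
  have xx: "(x, x) \<notin> F" using assms(2) by (simp add: irrefl_def)
  have "inj_on (f(x := z)) (insert x W)"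
    using f(1) z(1) insert.hyps by (auto simp: inj_on_def)
  moreover have "\<forall>u\<in>insert x W. \<forall>v\<in>insert x W.
      (u, v) \<in> F \<longleftrightarrow> ((f(x := z)) u, (f(x := z)) v) \<in> code_digraph"
  proof (intro ballI)
    fix u v assume "u \<in> insert x W" "v \<in> insert x W"
    then consider "u \<in> W" "v \<in> W" | "u \<in> W" "v = x" | "u = x" "v \<in> W" | "u = x" "v = x"
      by blast
    then show "(u, v) \<in> F \<longleftrightarrow> ((f(x := z)) u, (f(x := z)) v) \<in> code_digraph"
      by cases (simp_all add: new ne f(2) xx irrefl_code_digraph)
  qed
  ultimately show ?case by (intro exI[of _ "f(x := z)"] conjI)
qed

lemma universal_digraph_exists: "universal_digraph UNIV code_digraph"
proof -
  have "age UNIV code_digraph = {(W, F). finite W \<and> is_digraph W F}"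
  proof (intro subset_antisym subrelI)
    fix W :: "nat set" and F
    assume "(W, F) \<in> age UNIV code_digraph"
    then obtain f where fin: "finite W" "F \<subseteq> W \<times> W"
      and f: "\<And>x y. x \<in> W \<Longrightarrow> y \<in> W \<Longrightarrow> (x, y) \<in> F \<longleftrightarrow> (f x, f y) \<in> code_digraph"
      unfolding age_def digraph_iso_def by blast
    have "(x, x) \<notin> F" for x using fin(2) f[of x x] irrefl_code_digraph by blast
    then show "(W, F) \<in> {(W, F). finite W \<and> is_digraph W F}"
      using fin by (simp add: is_digraph_def irrefl_def)
  next
    fix W :: "nat set" and F
    assume "(W, F) \<in> {(W, F). finite W \<and> is_digraph W F}"
    then have W: "finite W" "F \<subseteq> W \<times> W" "irrefl F" by (simp_all add: is_digraph_def)
    obtain f where "inj_on f W" "\<forall>x\<in>W. \<forall>y\<in>W. (x, y) \<in> F \<longleftrightarrow> (f x, f y) \<in> code_digraph"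
      using finite_digraph_embeds_code_digraph[OF W(1,3)] by blast
    then have "digraph_iso W F (f ` W) code_digraph f"
      by (simp add: digraph_iso_def bij_betw_def)
    then show "(W, F) \<in> age UNIV code_digraph" using W(1,2) by (auto simp: age_def)
  qed
  then show ?thesis
    unfolding universal_digraph_def
    by (simp add: is_digraph_def irrefl_def irrefl_code_digraph ultrahomogeneous_code_digraph)
qed

end

theory Submission
  imports Defs
begin

text \<open>
  An endomorphism \<open>f\<close> of \<open>D\<close> carries the digraph on its image whose edges are the images of the
  edges of \<open>D\<close>. Its isomorphism type is an invariant of the \<open>\<D>\<close>-class of \<open>f\<close>, and if \<open>f\<close> is
  regular, these edges are all the edges of \<open>D\<close> inside the image.

  Let \<open>X\<close> be an infinite complete subgraph of \<open>D\<close> such that each vertex outside \<open>X\<close> has only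
  finitely many neighbours in \<open>X\<close>; then every injection of \<open>X\<close> into itself extends to an endomorphism
  of \<open>D\<close>. Let \<open>\<Delta>\<close> be a countably infinite digraph in which every finite set of vertices has a common
  neighbour in both directions. A generic homomorphism \<open>D \<rightarrow> \<Delta>\<close> lifts all automorphisms of
  \<open>\<Delta>\<close>; followed by a bijection \<open>\<Delta> \<rightarrow> X\<close> it is an endomorphism with image digraph \<open>\<Delta>\<close>, which
  is non-regular if \<open>\<Delta>\<close> is not complete and for which the Schuetzenberger group is \<open>Aut \<Delta>\<close>.

  Finally, for \<open>S \<subseteq> \<nat>\<close> let \<open>\<Delta>\<close> be the join of \<open>\<Gamma>\<close> with a rigid digraph on \<open>\<nat>\<close> that
  encodes \<open>S\<close>: then \<open>Aut \<Delta> = Aut \<Gamma>\<close>, and different sets \<open>S\<close> give non-isomorphic digraphs.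
\<close>

section \<open>Extending maps on the universal digraph\<close>

text \<open>The one-point extension of \<open>A\<close> with the prescribed edges is a finite
  digraph, so the age contains a copy of it. Ultrahomogeneity moves the copy of \<open>A\<close>
  back onto \<open>A\<close>, and the extra vertex is carried along to \<open>z\<close>.\<close>

lemma universal_digraph_extension:
  assumes univ: "universal_digraph V E" and A: "finite A" "A \<subseteq> V"
  obtains z where "z \<in> V" "z \<notin> A" "\<And>a. a \<in> A \<Longrightarrow> (z, a) \<in> E \<longleftrightarrow> a \<in> S"
    "\<And>a. a \<in> A \<Longrightarrow> (a, z) \<in> E \<longleftrightarrow> a \<in> T"
proof -
  obtain h :: "_ \<Rightarrow> nat" where h: "inj_on h A"
    using finite_imp_inj_to_nat_seg[OF A(1)] by blast
  have ultra: "ultrahomogeneous V E" using univ by (simp add: universal_digraph_def)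
  \<comment> \<open>The shift by one keeps 0 free for the new vertex.\<close>
  define k where "k = (\<lambda>a. Suc (h a))"
  have k: "inj_on k A" using h by (simp add: k_def inj_on_def)
  have k0: "k a \<noteq> 0" for a by (simp add: k_def)
  define N where "N = insert 0 (k ` A)"
  define G where "G = {(k a, k b) | a b. a \<in> A \<and> b \<in> A \<and> (a, b) \<in> E} \<union>
    {(0, k a) | a. a \<in> A \<inter> S} \<union> {(k a, 0) | a. a \<in> A \<inter> T}"
  have irr: "(x, x) \<notin> E" for x
    using univ by (simp add: universal_digraph_def is_digraph_def irrefl_def)
  have keq: "k a = k b \<longleftrightarrow> a = b" if "a \<in> A" "b \<in> A" for a b
    using k that by (auto simp: inj_on_def)
  have "irrefl G" unfolding irrefl_def G_def using k0 keq irr by (auto simp: k_def)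
  moreover have "G \<subseteq> N \<times> N" unfolding G_def N_def by auto
  ultimately have "(N, G) \<in> age V E"
    using univ A(1) by (simp add: universal_digraph_def is_digraph_def N_def)
  then obtain B g where B: "B \<subseteq> V" and g: "digraph_iso N G B E g"
    unfolding age_def by auto
  have Gk: "(k a, k b) \<in> G \<longleftrightarrow> (a, b) \<in> E" if "a \<in> A" "b \<in> A" for a b
    unfolding G_def using that k0 keq by (auto simp: k_def)
  have Gz: "(0, k a) \<in> G \<longleftrightarrow> a \<in> S" "(k a, 0) \<in> G \<longleftrightarrow> a \<in> T" if "a \<in> A" for a
    unfolding G_def using that k0 keq by (auto simp: k_def)
  have gN: "inj_on g N" "g ` N = B" using g by (auto simp: digraph_iso_def bij_betw_def)
  have gE: "(x, y) \<in> G \<longleftrightarrow> (g x, g y) \<in> E" if "x \<in> N" "y \<in> N" for x y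
    using g that by (auto simp: digraph_iso_def)
  define q where "q = (\<lambda>a. g (k a))"
  have q: "inj_on q A"
    unfolding q_def using gN(1) keq by (auto simp: inj_on_def N_def)
  have qE: "(a, b) \<in> E \<longleftrightarrow> (q a, q b) \<in> E" if "a \<in> A" "b \<in> A" for a b
    using Gk[OF that] gE[of "k a" "k b"] that by (simp add: q_def N_def)
  \<comment> \<open>The finite partial isomorphism that ultrahomogeneity extends: it takes the
    embedded copy of \<open>A\<close> back to \<open>A\<close>.\<close>
  have "digraph_iso (q ` A) E A E (the_inv_into A q)"
    unfolding digraph_iso_def
    using q qE by (auto simp: the_inv_into_f_f bij_betw_the_inv_into bij_betw_imageI)
  moreover have "q ` A \<subseteq> V" using B gN by (auto simp: q_def N_def)
  ultimately have "\<exists>\<phi>. digraph_iso V E V E \<phi> \<and> (\<forall>x\<in>q ` A. \<phi> x = the_inv_into A q x)"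
    using ultra[unfolded ultrahomogeneous_def, rule_format, of "q ` A" A "the_inv_into A q"] A
    by blast
  then obtain \<phi> where \<phi>: "digraph_iso V E V E \<phi>"
    "\<And>x. x \<in> q ` A \<Longrightarrow> \<phi> x = the_inv_into A q x" by blast
  have \<phi>q: "\<phi> (q a) = a" if "a \<in> A" for a using \<phi>(2) q that by (simp add: the_inv_into_f_f)
  have g0: "g 0 \<in> V" using B gN by (auto simp: N_def)
  have \<phi>E: "(x, y) \<in> E \<longleftrightarrow> (\<phi> x, \<phi> y) \<in> E" if "x \<in> V" "y \<in> V" for x y
    using \<phi>(1) that by (auto simp: digraph_iso_def)
  have qV: "q a \<in> V" if "a \<in> A" for a using that \<open>q ` A \<subseteq> V\<close> by blast
  show thesis
  proof
    show "\<phi> (g 0) \<in> V" using \<phi>(1) g0 by (auto simp: digraph_iso_def bij_betw_def)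
    show "\<phi> (g 0) \<notin> A"
    proof
      assume a: "\<phi> (g 0) \<in> A"
      have "inj_on \<phi> V" using \<phi>(1) by (simp add: digraph_iso_def bij_betw_def)
      then have "q (\<phi> (g 0)) = g 0" using \<phi>q[OF a] g0 qV[OF a] by (simp add: inj_on_def)
      then have "k (\<phi> (g 0)) = 0" using gN(1) a by (auto simp: q_def N_def inj_on_def)
      then show False using k0 by blast
    qed
    fix a assume a: "a \<in> A"
    show "(\<phi> (g 0), a) \<in> E \<longleftrightarrow> a \<in> S"
      using \<phi>E[OF g0 qV[OF a]] \<phi>q[OF a] gE[of 0 "k a"] Gz[OF a] a by (simp add: q_def N_def)
    show "(a, \<phi> (g 0)) \<in> E \<longleftrightarrow> a \<in> T"
      using \<phi>E[OF qV[OF a] g0] \<phi>q[OF a] gE[of "k a" 0] Gz[OF a] a by (simp add: q_def N_def)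
  qed
qed

text \<open>A recursion shared by both constructions of endomorphisms below. The vertices outside
  \<open>X\<close> receive their values one after another, with \<open>Q\<close> as the invariant
  kept along the way. An edge that is not inside \<open>X\<close> is secured when its later endpoint
  is treated, vertices of \<open>X\<close> counting as the earliest.\<close>

lemma hom_extension:
  assumes V: "countable V" "X \<subseteq> V" and E: "E \<subseteq> V \<times> V" "irrefl E"
    and hom: "\<And>x y. x \<in> X \<Longrightarrow> y \<in> X \<Longrightarrow> (x, y) \<in> E \<Longrightarrow> (t0 x, t0 y) \<in> E'"
    and step: "\<And>x A t. \<lbrakk>x \<in> V - X; finite A; A \<subseteq> V - X; x \<notin> A; \<And>y. y \<in> X \<Longrightarrow> t y = t0 y;
        \<And>y. y \<in> A \<Longrightarrow> Q y (t y)\<rbrakk> \<Longrightarrow> \<exists>z. Q x z \<and>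
          (\<forall>y\<in>X \<union> A. ((x, y) \<in> E \<longrightarrow> (z, t y) \<in> E') \<and> ((y, x) \<in> E \<longrightarrow> (t y, z) \<in> E'))"
  obtains t where "\<And>x. x \<in> X \<Longrightarrow> t x = t0 x" "\<And>x. x \<in> V - X \<Longrightarrow> Q x (t x)"
    "\<And>x y. (x, y) \<in> E \<Longrightarrow> (t x, t y) \<in> E'"
proof -
  define idx where "idx = to_nat_on V"
  have idx: "inj_on idx V" using V(1) unfolding idx_def by (rule inj_on_to_nat_on)
  define below where "below = (\<lambda>x. {y \<in> V - X. idx y < idx x})"
  \<comment> \<open>Values on \<open>X\<close> are always read from \<open>t0\<close>, so the
    condition \<open>P\<close> at \<open>x\<close> depends only on values at vertices of smaller
    index, as well-founded choice demands.\<close>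
  define ext where "ext = (\<lambda>t y. if y \<in> X then t0 y else t y)"
  define P where "P = (\<lambda>t x z. x \<in> V - X \<longrightarrow> Q x z \<and> (\<forall>y\<in>X \<union> below x.
      ((x, y) \<in> E \<longrightarrow> (z, ext t y) \<in> E') \<and> ((y, x) \<in> E \<longrightarrow> (ext t y, z) \<in> E')))"
  have "\<exists>t. \<forall>x. P t x (t x)"
  proof (rule dependent_wf_choice)
    show "wf (inv_image less_than idx)" by simp
    show "P f x r = P g x r" if "\<And>z. (z, x) \<in> inv_image less_than idx \<Longrightarrow> f z = g z" for f g x r
    proof -
      have "ext f y = ext g y" if "y \<in> X \<union> below x" for y
        using that \<open>\<And>z. (z, x) \<in> inv_image less_than idx \<Longrightarrow> f z = g z\<close>[of y]
        by (auto simp: ext_def below_def)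
      then show ?thesis unfolding P_def by (intro arg_cong2[where f = "(\<longrightarrow>)"] arg_cong2[where f = "(\<and>)"] ball_cong refl) simp_all
    qed
    fix x f assume f: "\<And>y. (y, x) \<in> inv_image less_than idx \<Longrightarrow> P f y (f y)"
    show "\<exists>r. P f x r"
    proof (cases "x \<in> V - X")
      case True
      have "finite (idx ` below x)" by (rule finite_subset[of _ "{..<idx x}"]) (auto simp: below_def)
      moreover have "inj_on idx (below x)" using idx by (auto simp: below_def inj_on_def)
      ultimately have fin: "finite (below x)" by (rule finite_imageD)
      have Q: "Q y (ext f y)" if "y \<in> below x" for y
        using that f[of y] by (simp add: below_def ext_def P_def)
      have "\<exists>z. Q x z \<and> (\<forall>y\<in>X \<union> below x.
          ((x, y) \<in> E \<longrightarrow> (z, ext f y) \<in> E') \<and> ((y, x) \<in> E \<longrightarrow> (ext f y, z) \<in> E'))"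
        by (rule step[OF True fin]) (use Q in \<open>auto simp: below_def ext_def\<close>)
      then show ?thesis unfolding P_def by blast
    next
      case False
      then show ?thesis unfolding P_def by blast
    qed
  qed
  then obtain t where t: "\<forall>x. P t x (t x)" by (rule exE)
  note t = t[rule_format]
  show thesis
  proof
    show "ext t x = t0 x" if "x \<in> X" for x using that by (simp add: ext_def)
    show "Q x (ext t x)" if "x \<in> V - X" for x using that t[of x] by (simp add: ext_def P_def)
    fix x y assume xy: "(x, y) \<in> E"
    then have xV: "x \<in> V" "y \<in> V" "x \<noteq> y" using E by (auto simp: irrefl_def)
    then have "idx x \<noteq> idx y" using idx by (auto simp: inj_on_def)
    then consider "x \<in> X" "y \<in> X" | "x \<notin> X" "y \<in> X \<union> below x" | "y \<notin> X" "x \<in> X \<union> below y"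
      using xV linorder_neqE_nat[of "idx x" "idx y"] unfolding below_def by blast
    then show "(ext t x, ext t y) \<in> E'"
    proof cases
      case 1 then show ?thesis using hom xy by (simp add: ext_def)
    next
      case 2
      then have "ext t x = t x" by (simp add: ext_def)
      then show ?thesis using t[of x] 2 xV xy unfolding P_def by simp
    next
      case 3
      then have "ext t y = t y" by (simp add: ext_def)
      then show ?thesis using t[of y] 3 xV xy unfolding P_def by simp
    qed
  qed
qed

section \<open>A clique in which every outside vertex has only finitely many neighbours\<close>

text \<open>A greedy choice: the \<open>n\<close>-th vertex is joined both ways to all vertices
  chosen before it, and is not adjacent to any of \<open>e 0\<close>, ..., \<open>e n\<close> that
  has not been chosen before. A vertex \<open>e k\<close> outside the clique can then be adjacent
  only to members chosen before stage \<open>k\<close>.\<close>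

lemma universal_digraph_clique:
  assumes univ: "universal_digraph V E"
  obtains x :: "nat \<Rightarrow> _" where "inj x" "range x \<subseteq> V" "\<And>m n. m \<noteq> n \<Longrightarrow> (x m, x n) \<in> E"
    "\<And>v. v \<in> V - range x \<Longrightarrow> finite {y \<in> range x. (v, y) \<in> E \<or> (y, v) \<in> E}"
proof -
  have ne: "V \<noteq> {}" using universal_digraph_extension[OF univ, of "{}"] by auto
  have cV: "countable V" using univ by (simp add: universal_digraph_def)
  define e where "e = from_nat_into V"
  have e: "range e = V" unfolding e_def by (rule range_from_nat_into[OF ne cV])
  define P where "P = (\<lambda>f n r. r \<in> V \<and> (\<forall>m<n. r \<noteq> f m \<and> (r, f m) \<in> E \<and> (f m, r) \<in> E) \<and>
      (\<forall>i\<le>n. e i \<notin> f ` {..<n} \<longrightarrow> (r, e i) \<notin> E \<and> (e i, r) \<notin> E))"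
  have "\<exists>f. \<forall>n. P f n (f n)"
  proof (rule dependent_wf_choice)
    show "wf less_than" by simp
    show "P f x r = P g x r" if "\<And>z. (z, x) \<in> less_than \<Longrightarrow> f z = g z" for f g x r
    proof -
      have "f ` {..<x} = g ` {..<x}" using that by auto
      then show ?thesis using that by (simp add: P_def)
    qed
    fix n f assume f: "\<And>y. (y, n) \<in> less_than \<Longrightarrow> P f y (f y)"
    have sub: "f ` {..<n} \<subseteq> V" using f by (auto simp: P_def)
    obtain z where z: "z \<in> V" "z \<notin> f ` {..<n} \<union> e ` {..n}"
      "\<And>a. a \<in> f ` {..<n} \<union> e ` {..n} \<Longrightarrow> (z, a) \<in> E \<longleftrightarrow> a \<in> f ` {..<n}"
      "\<And>a. a \<in> f ` {..<n} \<union> e ` {..n} \<Longrightarrow> (a, z) \<in> E \<longleftrightarrow> a \<in> f ` {..<n}"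
      using universal_digraph_extension[OF univ, where A = "f ` {..<n} \<union> e ` {..n}"
          and S = "f ` {..<n}" and T = "f ` {..<n}"] sub e by blast
    have "P f n z"
      unfolding P_def
    proof (intro conjI allI impI)
      fix m assume "m < n"
      then have m: "f m \<in> f ` {..<n}" by simp
      show "z \<noteq> f m" using z(2) m by blast
      show "(z, f m) \<in> E" "(f m, z) \<in> E" using z(3,4)[of "f m"] m by simp_all
    next
      fix i assume i: "i \<le> n" "e i \<notin> f ` {..<n}"
      then show "(z, e i) \<notin> E" "(e i, z) \<notin> E" using z(3,4)[of "e i"] by simp_all
    qed (rule z)
    then show "\<exists>r. P f n r" ..
  qed
  then obtain x where x: "\<forall>n. P x n (x n)" by (rule exE)
  note x = x[rule_format]
  have lt: "x n \<noteq> x m \<and> (x n, x m) \<in> E \<and> (x m, x n) \<in> E" if "m < n" for m n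
    using x[of n] that by (simp add: P_def)
  show thesis
  proof
    show "inj x" by (metis lt injI linorder_neqE_nat)
    show "range x \<subseteq> V" using x by (auto simp: P_def)
    show "(x m, x n) \<in> E" if "m \<noteq> n" for m n using lt that by (metis linorder_neqE_nat)
    fix v assume v: "v \<in> V - range x"
    then obtain k where k: "v = e k" using e by auto
    have "{y \<in> range x. (v, y) \<in> E \<or> (y, v) \<in> E} \<subseteq> x ` {..<k}"
    proof clarify
      fix n assume "(v, x n) \<in> E \<or> (x n, v) \<in> E"
      moreover have "e k \<notin> x ` {..<n}" using v k by auto
      ultimately have "\<not> k \<le> n" using x[of n] k by (auto simp: P_def)
      then show "x n \<in> x ` {..<k}" by simp
    qed
    then show "finite {y \<in> range x. (v, y) \<in> E \<or> (y, v) \<in> E}" by (rule finite_subset) simp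
  qed
qed

text \<open>Injectivity of \<open>a\<close> keeps edges inside the clique. A vertex outside
  \<open>X\<close> has to respect only finitely many constraints, coming from vertices treated
  earlier and from its finitely many neighbours in \<open>X\<close>, and the extension property
  supplies a value joined both ways to all their images.\<close>

lemma clique_map_extends:
  assumes univ: "universal_digraph V E" and X: "X \<subseteq> V"
    and clique: "\<And>x y. x \<in> X \<Longrightarrow> y \<in> X \<Longrightarrow> x \<noteq> y \<Longrightarrow> (x, y) \<in> E"
    and fin: "\<And>v. v \<in> V - X \<Longrightarrow> finite {y \<in> X. (v, y) \<in> E \<or> (y, v) \<in> E}"
    and a: "inj_on a X" "a ` X \<subseteq> X"
  obtains t where "t \<in> carrier (End_monoid V E)" "\<And>x. x \<in> X \<Longrightarrow> t x = a x"
proof -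
  have E: "E \<subseteq> V \<times> V" "irrefl E" "countable V"
    using univ by (auto simp: universal_digraph_def is_digraph_def)
  obtain t where t: "\<And>x. x \<in> X \<Longrightarrow> t x = a x" "\<And>x. x \<in> V - X \<Longrightarrow> t x \<in> V"
    "\<And>x y. (x, y) \<in> E \<Longrightarrow> (t x, t y) \<in> E"
  proof (rule hom_extension[OF E(3) X E(1,2), where ?t0.0 = a and E' = E and Q = "\<lambda>_ z. z \<in> V"])
    show "(a x, a y) \<in> E" if "x \<in> X" "y \<in> X" "(x, y) \<in> E" for x y
    proof (rule clique)
      show "a x \<in> X" "a y \<in> X" using that a(2) by auto
      show "a x \<noteq> a y" using that a(1) E(2) by (auto simp: inj_on_def irrefl_def)
    qed
    fix x A t
    assume x: "x \<in> V - X" and A: "finite A" "A \<subseteq> V - X" and t: "\<And>y. y \<in> X \<Longrightarrow> t y = a y"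
      "\<And>y. y \<in> A \<Longrightarrow> t y \<in> V"
    define B where "B = t ` (A \<union> {y \<in> X. (x, y) \<in> E \<or> (y, x) \<in> E})"
    have "finite B" using A fin[OF x] by (simp add: B_def)
    moreover have "B \<subseteq> V" using t a(2) X by (auto simp: B_def)
    ultimately obtain z where "z \<in> V" "\<And>b. b \<in> B \<Longrightarrow> (z, b) \<in> E" "\<And>b. b \<in> B \<Longrightarrow> (b, z) \<in> E"
      using universal_digraph_extension[OF univ, of B B B] by metis
    then show "\<exists>z. z \<in> V \<and> (\<forall>y\<in>X \<union> A. ((x, y) \<in> E \<longrightarrow> (z, t y) \<in> E) \<and> ((y, x) \<in> E \<longrightarrow> (t y, z) \<in> E))"
      unfolding B_def by blast
  qed blast
  show thesis
  proof
    have "t x \<in> V" if "x \<in> V" for x using t(1,2) a(2) X that by (cases "x \<in> X") auto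
    then show "restrict t V \<in> carrier (End_monoid V E)"
      using t(3) E(1) by (auto simp: End_monoid_def)
    show "restrict t V x = a x" if "x \<in> X" for x using that t(1) X by auto
  qed
qed

section \<open>Generic homomorphisms\<close>

text \<open>The finite approximations from which a generic homomorphism is assembled.\<close>

definition partial_hom :: "'v set \<Rightarrow> 'v rel \<Rightarrow> 'u set \<Rightarrow> 'u rel \<Rightarrow> ('v \<rightharpoonup> 'u) \<Rightarrow> bool" where
  "partial_hom V E U F s \<longleftrightarrow> finite (dom s) \<and> dom s \<subseteq> V \<and> ran s \<subseteq> U \<and>
     (\<forall>x y a b. (x, y) \<in> E \<longrightarrow> s x = Some a \<longrightarrow> s y = Some b \<longrightarrow> (a, b) \<in> F)"

lemma partial_hom_upd:
  assumes s: "partial_hom V E U F s" and irr: "irrefl E"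
    and z: "z \<in> V" "z \<notin> dom s" "u \<in> U"
    and out: "\<And>y b. s y = Some b \<Longrightarrow> (z, y) \<in> E \<Longrightarrow> (u, b) \<in> F"
    and inc: "\<And>y b. s y = Some b \<Longrightarrow> (y, z) \<in> E \<Longrightarrow> (b, u) \<in> F"
  shows "partial_hom V E U F (s(z \<mapsto> u))" "s \<subseteq>\<^sub>m s(z \<mapsto> u)"
proof -
  have "(a, b) \<in> F"
    if "(x, y) \<in> E" "(s(z \<mapsto> u)) x = Some a" "(s(z \<mapsto> u)) y = Some b" for x y a b
  proof -
    have "x \<noteq> y" using that(1) irr by (auto simp: irrefl_def)
    then consider "x = z" "y \<noteq> z" | "x \<noteq> z" "y = z" | "x \<noteq> z" "y \<noteq> z" by blast
    then show ?thesis
    proof cases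
      case 1 then show ?thesis using that out by simp
    next
      case 2 then show ?thesis using that inc by simp
    next
      case 3
      then have "s x = Some a" "s y = Some b" using that(2,3) by simp_all
      then show ?thesis using s that(1) unfolding partial_hom_def by blast
    qed
  qed
  moreover have "ran (s(z \<mapsto> u)) \<subseteq> U"
    using s z(3) by (auto simp: partial_hom_def ran_def split: if_splits)
  ultimately show "partial_hom V E U F (s(z \<mapsto> u))"
    using s z(1) unfolding partial_hom_def by (simp add: subset_iff)
  show "s \<subseteq>\<^sub>m s(z \<mapsto> u)" using z(2) by (auto simp: map_le_def)
qed

text \<open>A new vertex is sent to a common two-way neighbour of all values taken so far, which
  respects whatever edges it has to the old domain.\<close>

lemma partial_hom_extend_dom:
  assumes s: "partial_hom V E U F s" and irr: "irrefl E" and A: "finite A" "A \<subseteq> V"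
    and closed: "\<And>S. finite S \<Longrightarrow> S \<subseteq> U \<Longrightarrow> \<exists>u\<in>U. \<forall>s\<in>S. (u, s) \<in> F \<and> (s, u) \<in> F"
  shows "\<exists>s'. partial_hom V E U F s' \<and> s \<subseteq>\<^sub>m s' \<and> A \<subseteq> dom s'"
  using A
proof (induction A rule: finite_induct)
  case empty
  then show ?case using s by (intro exI[of _ s]) auto
next
  case (insert x A)
  then obtain s' where s': "partial_hom V E U F s'" "s \<subseteq>\<^sub>m s'" "A \<subseteq> dom s'" by auto
  show ?case
  proof (cases "x \<in> dom s'")
    case True
    then show ?thesis using s' by blast
  next
    case False
    have "finite (ran s')" "ran s' \<subseteq> U" using s'(1) by (simp_all add: partial_hom_def finite_ran)
    then obtain u where u: "u \<in> U" "\<And>b. b \<in> ran s' \<Longrightarrow> (u, b) \<in> F \<and> (b, u) \<in> F"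
      using closed by meson
    have "partial_hom V E U F (s'(x \<mapsto> u))" "s' \<subseteq>\<^sub>m s'(x \<mapsto> u)"
      using partial_hom_upd[OF s'(1) irr _ False u(1)] u(2) insert.prems by (auto simp: ran_def)
    moreover have "insert x A \<subseteq> dom (s'(x \<mapsto> u))" using s'(3) by auto
    ultimately show ?thesis using map_le_trans[OF s'(2)] by blast
  qed
qed

text \<open>The new vertex \<open>z\<close> is chosen with no edges to or from \<open>dom s\<close>
  except those from \<open>A\<close> and those to \<open>B\<close>. Sending it to \<open>u\<close>
  therefore demands only the edges assumed in \<open>F\<close>.\<close>

lemma partial_hom_realise:
  assumes univ: "universal_digraph V E" and s: "partial_hom V E U F s"
    and A: "A \<subseteq> dom s" "B \<subseteq> dom s" and u: "u \<in> U"
    and inc: "\<And>a. a \<in> A \<Longrightarrow> (the (s a), u) \<in> F" and out: "\<And>b. b \<in> B \<Longrightarrow> (u, the (s b)) \<in> F"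
  obtains s' z where "partial_hom V E U F s'" "s \<subseteq>\<^sub>m s'" "s' z = Some u"
    "\<And>a. a \<in> A \<Longrightarrow> (a, z) \<in> E" "\<And>b. b \<in> B \<Longrightarrow> (z, b) \<in> E"
proof -
  have fin: "finite (dom s)" "dom s \<subseteq> V" using s by (simp_all add: partial_hom_def)
  obtain z where z: "z \<in> V" "z \<notin> dom s" "\<And>a. a \<in> dom s \<Longrightarrow> (z, a) \<in> E \<longleftrightarrow> a \<in> B"
    "\<And>a. a \<in> dom s \<Longrightarrow> (a, z) \<in> E \<longleftrightarrow> a \<in> A"
    using universal_digraph_extension[OF univ fin, of B A] by blast
  have irr: "irrefl E" using univ by (simp add: universal_digraph_def is_digraph_def)
  have "(u, b) \<in> F" if "s y = Some b" "(z, y) \<in> E" for y b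
    using out[of y] z(3)[of y] that by (auto simp: dom_def)
  moreover have "(b, u) \<in> F" if "s y = Some b" "(y, z) \<in> E" for y b
    using inc[of y] z(4)[of y] that by (auto simp: dom_def)
  ultimately have "partial_hom V E U F (s(z \<mapsto> u))" "s \<subseteq>\<^sub>m s(z \<mapsto> u)"
    using partial_hom_upd[OF s irr z(1,2) u] by blast+
  then show thesis using that[of "s(z \<mapsto> u)" z] z(3,4) A by (simp add: subset_iff)
qed

text \<open>A saturation property: each fibre contains a vertex attached to given finite sets in
  every way that the target permits. Empty \<open>A\<close> and \<open>B\<close> give surjectivity
  onto \<open>U\<close>.\<close>

definition generic_map :: "'v set \<Rightarrow> 'v rel \<Rightarrow> 'u set \<Rightarrow> 'u rel \<Rightarrow> ('v \<Rightarrow> 'u) \<Rightarrow> bool" where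
  "generic_map V E U F p \<longleftrightarrow> (\<forall>u\<in>U. \<forall>A B. finite A \<and> finite B \<and> A \<subseteq> V \<and> B \<subseteq> V \<and>
     (\<forall>a\<in>A. (p a, u) \<in> F) \<and> (\<forall>b\<in>B. (u, p b) \<in> F) \<longrightarrow>
     (\<exists>z\<in>V. p z = u \<and> (\<forall>a\<in>A. (a, z) \<in> E) \<and> (\<forall>b\<in>B. (z, b) \<in> E)))"

lemma generic_mapD:
  assumes "generic_map V E U F p" "u \<in> U" "finite A" "finite B" "A \<subseteq> V" "B \<subseteq> V"
    "\<And>a. a \<in> A \<Longrightarrow> (p a, u) \<in> F" "\<And>b. b \<in> B \<Longrightarrow> (u, p b) \<in> F"
  shows "\<exists>z\<in>V. p z = u \<and> (\<forall>a\<in>A. (a, z) \<in> E) \<and> (\<forall>b\<in>B. (z, b) \<in> E)"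
  using assms unfolding generic_map_def by simp

text \<open>The union of a chain of finite partial homomorphisms. There are countably many
  requirements \<open>(u, A, B)\<close>, and stage \<open>n + 1\<close> of the chain meets the
  \<open>n\<close>-th of them.\<close>

lemma generic_hom:
  assumes univ: "universal_digraph V E" and U: "countable U" "U \<noteq> {}"
    and closed: "\<And>S. finite S \<Longrightarrow> S \<subseteq> U \<Longrightarrow> \<exists>u\<in>U. \<forall>s\<in>S. (u, s) \<in> F \<and> (s, u) \<in> F"
  obtains p where "p \<in> V \<rightarrow> U" "\<And>x y. (x, y) \<in> E \<Longrightarrow> (p x, p y) \<in> F"
    "generic_map V E U F p"
proof -
  have VE: "countable V" "irrefl E" "E \<subseteq> V \<times> V"
    using univ by (auto simp: universal_digraph_def is_digraph_def)
  define fins where "fins = {A. A \<subseteq> V \<and> finite A}"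
  define Req where "Req = U \<times> fins \<times> fins"
  have "countable fins"
    unfolding fins_def using countable_Collect_finite_subset[OF VE(1)] by (simp add: conj_commute)
  then have cR: "countable Req" using U(1) by (simp add: Req_def)
  have "({} :: _ set) \<in> fins" by (simp add: fins_def)
  then have nR: "Req \<noteq> {}" using U(2) by (auto simp: Req_def)
  define r where "r = from_nat_into Req"
  have r: "range r = Req" unfolding r_def by (rule range_from_nat_into[OF nR cR])
  \<comment> \<open>Once \<open>A \<union> B\<close> lies in the domain, the values there are final.
    The premise on \<open>u\<close> is thus decided for good, and either it fails or a witness must
    be present.\<close>
  define met where "met = (\<lambda>s (u, A, B). A \<union> B \<subseteq> dom s \<and>
      ((\<forall>a\<in>A. (the (s a), u) \<in> F) \<and> (\<forall>b\<in>B. (u, the (s b)) \<in> F) \<longrightarrow>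
       (\<exists>z. s z = Some u \<and> (\<forall>a\<in>A. (a, z) \<in> E) \<and> (\<forall>b\<in>B. (z, b) \<in> E))))"
  have step: "\<exists>s'. partial_hom V E U F s' \<and> s \<subseteq>\<^sub>m s' \<and> met s' q"
    if s: "partial_hom V E U F s" and q: "q \<in> Req" for s q
  proof -
    obtain u A B where q': "q = (u, A, B)" "u \<in> U" "finite (A \<union> B)" "A \<union> B \<subseteq> V"
      using q by (auto simp: Req_def fins_def)
    obtain s1 where s1: "partial_hom V E U F s1" "s \<subseteq>\<^sub>m s1" "A \<union> B \<subseteq> dom s1"
      using partial_hom_extend_dom[OF s VE(2) q'(3,4) closed] by blast
    show ?thesis
    proof (cases "(\<forall>a\<in>A. (the (s1 a), u) \<in> F) \<and> (\<forall>b\<in>B. (u, the (s1 b)) \<in> F)")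
      case True
      obtain s2 z where s2: "partial_hom V E U F s2" "s1 \<subseteq>\<^sub>m s2" "s2 z = Some u"
        "\<And>a. a \<in> A \<Longrightarrow> (a, z) \<in> E" "\<And>b. b \<in> B \<Longrightarrow> (z, b) \<in> E"
        using partial_hom_realise[OF univ s1(1) _ _ q'(2), of A B] True s1(3) by blast
      have "A \<union> B \<subseteq> dom s2" using s1(3) map_le_implies_dom_le[OF s2(2)] by blast
      then have "met s2 q" unfolding met_def q'(1) prod.case using s2(3-5) by blast
      then show ?thesis using s2(1) map_le_trans[OF s1(2) s2(2)] by blast
    next
      case False
      then have "met s1 q" unfolding met_def q'(1) prod.case using s1(3) by blast
      then show ?thesis using s1(1,2) by blast
    qed
  qed
  have "\<exists>s. \<forall>n. partial_hom V E U F (s n) \<and> (s n \<subseteq>\<^sub>m s (Suc n) \<and> met (s (Suc n)) (r n))"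
  proof (rule dependent_nat_choice)
    show "\<exists>s. partial_hom V E U F s"
      by (intro exI[of _ Map.empty]) (simp add: partial_hom_def)
    show "\<exists>s'. partial_hom V E U F s' \<and> s \<subseteq>\<^sub>m s' \<and> met s' (r n)"
      if "partial_hom V E U F s" for s n using step[OF that, of "r n"] r by blast
  qed
  then obtain s where s: "\<forall>n. partial_hom V E U F (s n) \<and> (s n \<subseteq>\<^sub>m s (Suc n) \<and> met (s (Suc n)) (r n))"
    by (rule exE)
  have ph: "partial_hom V E U F (s n)" and met: "met (s (Suc n)) (r n)" and suc: "s n \<subseteq>\<^sub>m s (Suc n)"
    for n using s by simp_all
  have mono: "s m \<subseteq>\<^sub>m s n" if "m \<le> n" for m n
    using that by (induction n rule: dec_induct) (auto intro: map_le_trans suc)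
  \<comment> \<open>The limit of the chain, read off at the first stage where \<open>x\<close> has a
    value.\<close>
  define p where "p = (\<lambda>x. the (s (LEAST n. x \<in> dom (s n)) x))"
  have p: "s n x = Some (p x)" if "x \<in> dom (s n)" for n x
  proof -
    define k where "k = (LEAST n. x \<in> dom (s n))"
    have k: "x \<in> dom (s k)" "k \<le> n"
      unfolding k_def using that by (rule LeastI, rule Least_le)
    then have "s k x = s n x" using mono[of k n] by (simp add: map_le_def)
    then show ?thesis using that unfolding p_def k_def[symmetric] by auto
  qed
  have dom: "\<exists>n. A \<subseteq> dom (s n)" if "finite A" "A \<subseteq> V" for A
  proof -
    obtain u where "u \<in> U" using U(2) by blast
    \<comment> \<open>Any requirement mentioning \<open>A\<close> will do here, since meeting it
      puts \<open>A\<close> into the domain.\<close>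
    then have "(u, A, A) \<in> range r" using that by (simp add: r Req_def fins_def)
    then obtain n where "r n = (u, A, A)" by auto
    then show ?thesis using met[of n] by (auto simp: met_def)
  qed
  show thesis
  proof
    show "p \<in> V \<rightarrow> U"
    proof
      fix x assume "x \<in> V"
      then obtain n where "x \<in> dom (s n)" using dom[of "{x}"] by auto
      then have "p x \<in> ran (s n)" using p[of x n] by (simp add: ranI)
      then show "p x \<in> U" using ph[of n] by (auto simp: partial_hom_def)
    qed
    fix x y assume xy: "(x, y) \<in> E"
    then obtain n where "{x, y} \<subseteq> dom (s n)" using dom[of "{x, y}"] VE(3) by auto
    then have "s n x = Some (p x)" "s n y = Some (p y)" using p by simp_all
    then show "(p x, p y) \<in> F" using ph[of n] xy unfolding partial_hom_def by blast
  next
    show "generic_map V E U F p"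
      unfolding generic_map_def
    proof (intro ballI allI impI, elim conjE)
      fix u A B assume h: "u \<in> U" "finite A" "finite B" "A \<subseteq> V" "B \<subseteq> V"
        "\<forall>a\<in>A. (p a, u) \<in> F" "\<forall>b\<in>B. (u, p b) \<in> F"
      then have "(u, A, B) \<in> range r" by (simp add: r Req_def fins_def)
      then obtain n where n: "r n = (u, A, B)" by auto
      have AB: "A \<union> B \<subseteq> dom (s (Suc n))" using met[of n] by (simp add: n met_def)
      have val: "the (s (Suc n) x) = p x" if "x \<in> A \<union> B" for x
      proof -
        have "x \<in> dom (s (Suc n))" using AB that by blast
        then show ?thesis using p by simp
      qed
      obtain z where z: "s (Suc n) z = Some u" "\<forall>a\<in>A. (a, z) \<in> E" "\<forall>b\<in>B. (z, b) \<in> E"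
        using met[of n] h(6,7) val by (auto simp: n met_def)
      have "z \<in> V" using z(1) ph[of "Suc n"] by (auto simp: partial_hom_def)
      moreover have "p z = u" using p[of z "Suc n"] z(1) by auto
      ultimately show "\<exists>z\<in>V. p z = u \<and> (\<forall>a\<in>A. (a, z) \<in> E) \<and> (\<forall>b\<in>B. (z, b) \<in> E)"
        using z by blast
    qed
  qed
qed

text \<open>The map \<open>s\<close> is built vertex by vertex. The value at \<open>x\<close> must
  lie in the fibre over \<open>a (p x)\<close> and be attached to finitely many earlier values; as
  \<open>p\<close> and \<open>a\<close> preserve edges, the target permits these attachments and
  genericity provides the vertex.\<close>

lemma generic_hom_lift:
  assumes univ: "universal_digraph V E" and p: "p \<in> V \<rightarrow> U"
    and hom: "\<And>x y. (x, y) \<in> E \<Longrightarrow> (p x, p y) \<in> F"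
    and gen: "generic_map V E U F p"
    and a: "a \<in> U \<rightarrow> U" "\<And>u v. (u, v) \<in> F \<Longrightarrow> (a u, a v) \<in> F"
  obtains s where "s \<in> carrier (End_monoid V E)" "\<And>x. x \<in> V \<Longrightarrow> p (s x) = a (p x)"
proof -
  have VE: "countable V" "E \<subseteq> V \<times> V" "irrefl E"
    using univ by (auto simp: universal_digraph_def is_digraph_def)
  obtain t where t: "\<And>x. x \<in> V - {} \<Longrightarrow> t x \<in> V \<and> p (t x) = a (p x)"
    "\<And>x y. (x, y) \<in> E \<Longrightarrow> (t x, t y) \<in> E"
  proof (rule hom_extension[OF VE(1) empty_subsetI VE(2,3),
        where ?t0.0 = id and E' = E and Q = "\<lambda>x z. z \<in> V \<and> p z = a (p x)"])
    fix x A t assume x: "x \<in> V - {}" and A: "finite A" "A \<subseteq> V - {}"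
      and t: "\<And>y. y \<in> A \<Longrightarrow> t y \<in> V \<and> p (t y) = a (p y)"
    have "a (p x) \<in> U" using a(1) p x by auto
    then have "\<exists>z\<in>V. p z = a (p x) \<and> (\<forall>b\<in>t ` {y \<in> A. (y, x) \<in> E}. (b, z) \<in> E) \<and>
        (\<forall>b\<in>t ` {y \<in> A. (x, y) \<in> E}. (z, b) \<in> E)"
      by (rule generic_mapD[OF gen]) (use A t a(2) hom in auto)
    then show "\<exists>z. (z \<in> V \<and> p z = a (p x)) \<and> (\<forall>y\<in>{} \<union> A. ((x, y) \<in> E \<longrightarrow> (z, t y) \<in> E) \<and> ((y, x) \<in> E \<longrightarrow> (t y, z) \<in> E))"
      by auto
  qed blast+
  show thesis
  proof
    show "restrict t V \<in> carrier (End_monoid V E)"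
      using t VE(2) by (auto simp: End_monoid_def)
    show "p (restrict t V x) = a (p x)" if "x \<in> V" for x using that t(1) by simp
  qed
qed

section \<open>Green's relations and automorphism groups\<close>

lemma (in monoid) green_L_iff:
  "(f, g) \<in> green_L G \<longleftrightarrow> f \<in> carrier G \<and> g \<in> carrier G \<and>
     (\<exists>u\<in>carrier G. f = u \<otimes> g) \<and> (\<exists>v\<in>carrier G. g = v \<otimes> f)"
proof -
  have mem: "h \<in> carrier G #> k \<longleftrightarrow> (\<exists>u\<in>carrier G. h = u \<otimes> k)" for h k
    by (auto simp: r_coset_def)
  have refl: "k \<in> carrier G #> k" if "k \<in> carrier G" for k
    unfolding mem using that by (intro bexI[of _ \<one>]) simp_all
  have sub: "carrier G #> u \<otimes> k \<subseteq> carrier G #> k" if "u \<in> carrier G" "k \<in> carrier G" for u k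
    using that by (auto simp: r_coset_def) (metis m_assoc m_closed)
  show ?thesis
  proof
    assume "(f, g) \<in> green_L G"
    then have "f \<in> carrier G" "g \<in> carrier G" "carrier G #> f = carrier G #> g"
      by (auto simp: green_L_def)
    then show "f \<in> carrier G \<and> g \<in> carrier G \<and>
        (\<exists>u\<in>carrier G. f = u \<otimes> g) \<and> (\<exists>v\<in>carrier G. g = v \<otimes> f)"
      using refl[of f] refl[of g] mem by auto
  next
    assume "f \<in> carrier G \<and> g \<in> carrier G \<and>
        (\<exists>u\<in>carrier G. f = u \<otimes> g) \<and> (\<exists>v\<in>carrier G. g = v \<otimes> f)"
    then obtain u v where h: "f \<in> carrier G" "g \<in> carrier G" "u \<in> carrier G" "v \<in> carrier G"
      "f = u \<otimes> g" "g = v \<otimes> f" by blast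
    have "carrier G #> f \<subseteq> carrier G #> g" using sub[OF h(3,2)] h(5) by simp
    moreover have "carrier G #> g \<subseteq> carrier G #> f" using sub[OF h(4,1)] h(6) by simp
    ultimately show "(f, g) \<in> green_L G" using h(1,2) by (simp add: green_L_def)
  qed
qed

lemma (in monoid) green_R_iff:
  "(f, g) \<in> green_R G \<longleftrightarrow> f \<in> carrier G \<and> g \<in> carrier G \<and>
     (\<exists>u\<in>carrier G. f = g \<otimes> u) \<and> (\<exists>v\<in>carrier G. g = f \<otimes> v)"
proof -
  have mem: "h \<in> k <# carrier G \<longleftrightarrow> (\<exists>u\<in>carrier G. h = k \<otimes> u)" for h k
    by (auto simp: l_coset_def)
  have refl: "k \<in> k <# carrier G" if "k \<in> carrier G" for k
    unfolding mem using that by (intro bexI[of _ \<one>]) simp_all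
  have sub: "(k \<otimes> u) <# carrier G \<subseteq> k <# carrier G" if "u \<in> carrier G" "k \<in> carrier G" for u k
    using that by (auto simp: l_coset_def) (metis m_assoc m_closed)
  show ?thesis
  proof
    assume "(f, g) \<in> green_R G"
    then have "f \<in> carrier G" "g \<in> carrier G" "f <# carrier G = g <# carrier G"
      by (auto simp: green_R_def)
    then show "f \<in> carrier G \<and> g \<in> carrier G \<and>
        (\<exists>u\<in>carrier G. f = g \<otimes> u) \<and> (\<exists>v\<in>carrier G. g = f \<otimes> v)"
      using refl[of f] refl[of g] mem by auto
  next
    assume "f \<in> carrier G \<and> g \<in> carrier G \<and>
        (\<exists>u\<in>carrier G. f = g \<otimes> u) \<and> (\<exists>v\<in>carrier G. g = f \<otimes> v)"
    then obtain u v where h: "f \<in> carrier G" "g \<in> carrier G" "u \<in> carrier G" "v \<in> carrier G"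
      "f = g \<otimes> u" "g = f \<otimes> v" by blast
    have "f <# carrier G \<subseteq> g <# carrier G" using sub[OF h(3,2)] h(5) by simp
    moreover have "g <# carrier G \<subseteq> f <# carrier G" using sub[OF h(4,1)] h(6) by simp
    ultimately show "(f, g) \<in> green_R G" using h(1,2) by (simp add: green_R_def)
  qed
qed

text \<open>If \<open>g \<otimes> k \<otimes> g = g\<close> and \<open>g = v \<otimes> f\<close>,
  then \<open>k \<otimes> v\<close> serves as the inner inverse of \<open>f\<close>.\<close>

lemma (in monoid) regular_element_green_L:
  assumes "(f, g) \<in> green_L G" "regular_element G g"
  shows "regular_element G f"
proof -
  obtain u v k where h: "f \<in> carrier G" "g \<in> carrier G" "u \<in> carrier G" "v \<in> carrier G"
    "k \<in> carrier G" "f = u \<otimes> g" "g = v \<otimes> f" "g \<otimes> k \<otimes> g = g"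
    using assms unfolding green_L_iff regular_element_def by blast
  have "f \<otimes> (k \<otimes> v) \<otimes> f = u \<otimes> (g \<otimes> k \<otimes> (v \<otimes> f))"
    using h(1-5) by (subst (1) h(6)) (simp add: m_assoc)
  also have "\<dots> = f" using h by metis
  finally show ?thesis unfolding regular_element_def using h(4,5) by blast
qed

text \<open>The dual argument: with \<open>g = f \<otimes> v\<close>, the inner inverse of
  \<open>f\<close> is \<open>v \<otimes> k\<close>.\<close>

lemma (in monoid) regular_element_green_R:
  assumes "(f, g) \<in> green_R G" "regular_element G g"
  shows "regular_element G f"
proof -
  obtain u v k where h: "f \<in> carrier G" "g \<in> carrier G" "u \<in> carrier G" "v \<in> carrier G"
    "k \<in> carrier G" "f = g \<otimes> u" "g = f \<otimes> v" "g \<otimes> k \<otimes> g = g"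
    using assms unfolding green_R_iff regular_element_def by blast
  have "f \<otimes> (v \<otimes> k) \<otimes> f = (f \<otimes> v) \<otimes> k \<otimes> (g \<otimes> u)"
    using h(1-5) by (subst (2) h(6)) (simp add: m_assoc)
  also have "\<dots> = (g \<otimes> k \<otimes> g) \<otimes> u" using h(1-5) by (subst h(7)[symmetric]) (simp add: m_assoc)
  also have "\<dots> = f" using h by metis
  finally show ?thesis unfolding regular_element_def using h(4,5) by blast
qed

section \<open>The endomorphism monoid of a digraph\<close>

lemma End_monoid_carrier_iff:
  "f \<in> carrier (End_monoid V E) \<longleftrightarrow> f \<in> V \<rightarrow>\<^sub>E V \<and> (\<forall>x y. (x, y) \<in> E \<longrightarrow> (f x, f y) \<in> E)"
  by (simp add: End_monoid_def)

lemma End_monoid_mult: "f \<otimes>\<^bsub>End_monoid V E\<^esub> g = compose V g f"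
  by (simp add: End_monoid_def)

lemma monoid_End_monoid:
  assumes "is_digraph V E"
  shows "monoid (End_monoid V E)"
proof (rule monoidI, goal_cases)
  case (1 f g)
  have "(compose V g f x, compose V g f y) \<in> E" if xy: "(x, y) \<in> E" for x y
  proof -
    have "x \<in> V" "y \<in> V" using xy assms by (auto simp: is_digraph_def)
    then show ?thesis using 1 xy by (simp add: compose_def End_monoid_carrier_iff)
  qed
  moreover have "compose V g f \<in> V \<rightarrow>\<^sub>E V"
    using 1 by (auto simp: compose_def End_monoid_carrier_iff PiE_iff Pi_iff)
  ultimately show ?case unfolding End_monoid_mult End_monoid_carrier_iff by blast
next
  case 2
  show ?case using assms by (auto simp: End_monoid_def is_digraph_def)
next
  case (3 f g h)
  then show ?case
    by (auto simp: End_monoid_mult End_monoid_carrier_iff intro!: compose_assoc)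
next
  case (4 f)
  then show ?case
    by (auto simp: End_monoid_def PiE_iff compose_def intro!: extensionalityI[of _ V])
next
  case (5 f)
  then show ?case
    by (auto simp: End_monoid_def PiE_iff compose_def intro!: extensionalityI[of _ V])
qed

section \<open>Digraph isomorphisms and automorphism groups\<close>

lemma digraph_iso_compose:
  assumes "digraph_iso A E B F f" "digraph_iso B F C G g"
  shows "digraph_iso A E C G (g \<circ> f)"
  unfolding digraph_iso_def
proof (intro conjI ballI)
  show "bij_betw (g \<circ> f) A C"
    using assms by (auto simp: digraph_iso_def intro: bij_betw_trans)
  fix x y assume xy: "x \<in> A" "y \<in> A"
  then have "f x \<in> B" "f y \<in> B" using assms(1) by (auto simp: digraph_iso_def bij_betw_def)
  then have "(f x, f y) \<in> F \<longleftrightarrow> (g (f x), g (f y)) \<in> G"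
    using assms(2) unfolding digraph_iso_def by blast
  moreover have "(x, y) \<in> E \<longleftrightarrow> (f x, f y) \<in> F"
    using assms(1) xy unfolding digraph_iso_def by blast
  ultimately show "(x, y) \<in> E \<longleftrightarrow> ((g \<circ> f) x, (g \<circ> f) y) \<in> G" by simp
qed

lemma digraph_iso_inv_into:
  assumes "digraph_iso A E B F f"
  shows "digraph_iso B F A E (inv_into A f)"
  unfolding digraph_iso_def
proof (intro conjI ballI)
  have f: "bij_betw f A B" using assms by (simp add: digraph_iso_def)
  then show "bij_betw (inv_into A f) B A" by (rule bij_betw_inv_into)
  fix x y assume xy: "x \<in> B" "y \<in> B"
  then have "inv_into A f x \<in> A" "inv_into A f y \<in> A" "f (inv_into A f x) = x" "f (inv_into A f y) = y"
    using f by (auto simp: bij_betw_def inv_into_into f_inv_into_f)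
  then show "(x, y) \<in> F \<longleftrightarrow> (inv_into A f x, inv_into A f y) \<in> E"
    using assms unfolding digraph_iso_def by metis
qed

lemma digraph_iso_cong:
  assumes "\<And>x. x \<in> A \<Longrightarrow> f x = g x"
  shows "digraph_iso A E B F f \<longleftrightarrow> digraph_iso A E B F g"
  using assms bij_betw_cong[of A f g B] by (simp add: digraph_iso_def)

lemma digraph_iso_mem: "digraph_iso A E B F f \<Longrightarrow> x \<in> A \<Longrightarrow> f x \<in> B"
  by (auto simp: digraph_iso_def bij_betw_def)

lemma Aut_group_carrier_iff:
  "a \<in> carrier (Aut_group V E) \<longleftrightarrow> a \<in> extensional V \<and> digraph_iso V E V E a"
  by (auto simp: Aut_group_def PiE_def digraph_iso_mem)

lemma Aut_group_mult: "a \<otimes>\<^bsub>Aut_group V E\<^esub> b = compose V b a"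
  by (simp add: Aut_group_def)

lemma Aut_group_restrict:
  "digraph_iso V E V E a \<Longrightarrow> restrict a V \<in> carrier (Aut_group V E)"
  using digraph_iso_cong[of V a "restrict a V"] by (simp add: Aut_group_carrier_iff)

lemma group_Aut_group: "group (Aut_group V E)"
proof (rule groupI, goal_cases)
  case (1 f g)
  then have "digraph_iso V E V E (g \<circ> f)"
    by (auto simp: Aut_group_carrier_iff intro: digraph_iso_compose)
  then show ?case
    using Aut_group_restrict[of V E "g \<circ> f"] by (simp add: Aut_group_mult compose_def comp_def)
next
  case 2
  have "digraph_iso V E V E (\<lambda>x. x)" by (auto simp: digraph_iso_def bij_betw_def)
  then show ?case using Aut_group_restrict[of V E "\<lambda>x. x"] by (simp add: Aut_group_def)
next
  case (3 f g h)
  then show ?case by (auto simp: Aut_group_def intro!: compose_assoc)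
next
  case (4 f)
  then show ?case
    by (auto simp: Aut_group_def PiE_iff compose_def intro!: extensionalityI[of _ V])
next
  case (5 f)
  then have f: "digraph_iso V E V E f" "f \<in> extensional V" by (auto simp: Aut_group_carrier_iff)
  have "f (inv_into V f x) = x" "inv_into V f x \<in> V" if "x \<in> V" for x
    using f(1) that by (auto simp: digraph_iso_def bij_betw_def inv_into_into f_inv_into_f)
  then have "restrict (inv_into V f) V \<otimes>\<^bsub>Aut_group V E\<^esub> f = \<one>\<^bsub>Aut_group V E\<^esub>"
    by (auto simp: Aut_group_def compose_def)
  then show ?case using Aut_group_restrict[OF digraph_iso_inv_into[OF f(1)]] by blast
qed

text \<open>Conjugation by \<open>f\<close>, restricted to \<open>B\<close> so that the results are
  extensional; conjugation by the inverse of \<open>f\<close> undoes it.\<close>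

lemma Aut_group_iso:
  assumes f: "digraph_iso A E B F f"
  shows "Aut_group A E \<cong> Aut_group B F"
proof -
  define g where "g = inv_into A f"
  have gi: "digraph_iso B F A E g" unfolding g_def by (rule digraph_iso_inv_into[OF f])
  have g: "g y \<in> A" "f (g y) = y" if "y \<in> B" for y
    using f that by (auto simp: digraph_iso_def g_def bij_betw_def inv_into_into f_inv_into_f)
  have gf: "g (f x) = x" if "x \<in> A" for x
    using f that by (auto simp: g_def digraph_iso_def bij_betw_def)
  have fB: "f x \<in> B" if "x \<in> A" for x by (rule digraph_iso_mem[OF f that])
  define \<Phi> where "\<Phi> = (\<lambda>a. restrict (f \<circ> (a \<circ> g)) B)"
  define \<Psi> where "\<Psi> = (\<lambda>b. restrict (g \<circ> (b \<circ> f)) A)"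
  have \<Phi>: "\<Phi> a \<in> carrier (Aut_group B F)" if "a \<in> carrier (Aut_group A E)" for a
    unfolding \<Phi>_def using that
    by (intro Aut_group_restrict digraph_iso_compose[OF _ f] digraph_iso_compose[OF gi])
      (simp add: Aut_group_carrier_iff)
  have \<Psi>: "\<Psi> b \<in> carrier (Aut_group A E)" if "b \<in> carrier (Aut_group B F)" for b
    unfolding \<Psi>_def using that
    by (intro Aut_group_restrict digraph_iso_compose[OF _ gi] digraph_iso_compose[OF f])
      (simp add: Aut_group_carrier_iff)
  have clA: "a x \<in> A" "a \<in> extensional A" if "a \<in> carrier (Aut_group A E)" "x \<in> A" for a x
    using that by (auto simp: Aut_group_carrier_iff digraph_iso_mem)
  have clB: "b x \<in> B" "b \<in> extensional B" if "b \<in> carrier (Aut_group B F)" "x \<in> B" for b x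
    using that by (auto simp: Aut_group_carrier_iff digraph_iso_mem)
  have "bij_betw \<Phi> (carrier (Aut_group A E)) (carrier (Aut_group B F))"
  proof (rule bij_betw_byWitness[where f' = \<Psi>])
    show "\<forall>a\<in>carrier (Aut_group A E). \<Psi> (\<Phi> a) = a"
    proof
      fix a assume a: "a \<in> carrier (Aut_group A E)"
      show "\<Psi> (\<Phi> a) = a"
      proof (rule extensionalityI[of _ A])
        show "\<Psi> (\<Phi> a) x = a x" if "x \<in> A" for x
          using that clA(1)[OF a that] by (simp add: \<Phi>_def \<Psi>_def fB gf)
      qed (use a in \<open>auto simp: \<Psi>_def Aut_group_carrier_iff\<close>)
    qed
    show "\<forall>b\<in>carrier (Aut_group B F). \<Phi> (\<Psi> b) = b"
    proof
      fix b assume b: "b \<in> carrier (Aut_group B F)"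
      show "\<Phi> (\<Psi> b) = b"
      proof (rule extensionalityI[of _ B])
        show "\<Phi> (\<Psi> b) x = b x" if "x \<in> B" for x
          using that clB(1)[OF b that] by (simp add: \<Phi>_def \<Psi>_def g)
      qed (use b in \<open>auto simp: \<Phi>_def Aut_group_carrier_iff\<close>)
    qed
  qed (use \<Phi> \<Psi> in auto)
  moreover have "\<Phi> \<in> hom (Aut_group A E) (Aut_group B F)"
  proof (rule homI)
    fix a b assume ab: "a \<in> carrier (Aut_group A E)" "b \<in> carrier (Aut_group A E)"
    show "\<Phi> (a \<otimes>\<^bsub>Aut_group A E\<^esub> b) = \<Phi> a \<otimes>\<^bsub>Aut_group B F\<^esub> \<Phi> b"
      unfolding Aut_group_mult using clA(1)[OF ab(1)] by (auto simp: \<Phi>_def compose_def g gf fB)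
  qed (rule \<Phi>)
  ultimately have "\<Phi> \<in> iso (Aut_group A E) (Aut_group B F)" by (simp add: iso_def)
  then show ?thesis by (auto simp: is_iso_def)
qed

section \<open>Image digraphs\<close>

definition image_edges :: "'v rel \<Rightarrow> ('v \<Rightarrow> 'w) \<Rightarrow> 'w rel" where
  "image_edges E f = map_prod f f ` E"

lemma image_edges_iff: "(a, b) \<in> image_edges E f \<longleftrightarrow> (\<exists>x y. (x, y) \<in> E \<and> a = f x \<and> b = f y)"
  by (auto simp: image_edges_def)

text \<open>The endomorphism \<^term>\<open>t\<close> extends the automorphism \<^term>\<open>a\<close> of the image digraph
  and \<^term>\<open>s\<close> lifts it along \<^term>\<open>f\<close>, so \<^term>\<open>a\<close> moves \<^term>\<open>f\<close> inside its
  \<open>\<H>\<close>-class.\<close>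

definition auts_extend_and_lift :: "'v set \<Rightarrow> 'v rel \<Rightarrow> ('v \<Rightarrow> 'v) \<Rightarrow> bool" where
  "auts_extend_and_lift V E f \<longleftrightarrow>
     (\<forall>a. digraph_iso (f ` V) (image_edges E f) (f ` V) (image_edges E f) a \<longrightarrow>
       (\<exists>t\<in>carrier (End_monoid V E). \<exists>s\<in>carrier (End_monoid V E).
          \<forall>x\<in>V. t (f x) = a (f x) \<and> f (s x) = a (f x)))"

lemma auts_extend_and_liftD:
  assumes "auts_extend_and_lift V E f"
    "digraph_iso (f ` V) (image_edges E f) (f ` V) (image_edges E f) a"
  obtains t s where "t \<in> carrier (End_monoid V E)" "s \<in> carrier (End_monoid V E)"
    "\<forall>x\<in>V. t (f x) = a (f x)" "\<forall>x\<in>V. f (s x) = a (f x)"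
proof -
  have "\<exists>t\<in>carrier (End_monoid V E). \<exists>s\<in>carrier (End_monoid V E).
      \<forall>x\<in>V. t (f x) = a (f x) \<and> f (s x) = a (f x)"
    using assms by (simp only: auts_extend_and_lift_def)
  then show thesis using that by auto
qed

section \<open>Image digraphs under Green's relations\<close>

locale digraph =
  fixes V :: "'v set" and E :: "'v rel"
  assumes digraph: "is_digraph V E"
begin

abbreviation M where "M \<equiv> End_monoid V E"

sublocale M: monoid M by (rule monoid_End_monoid[OF digraph])

lemma E_sub: "E \<subseteq> V \<times> V"
  using digraph by (simp add: is_digraph_def)

lemma M_mem: "f \<in> carrier M \<Longrightarrow> x \<in> V \<Longrightarrow> f x \<in> V"
  by (auto simp: End_monoid_carrier_iff)

lemma M_edge: "f \<in> carrier M \<Longrightarrow> (x, y) \<in> E \<Longrightarrow> (f x, f y) \<in> E"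
  by (auto simp: End_monoid_carrier_iff)

lemma M_ext: "f \<in> carrier M \<Longrightarrow> g \<in> carrier M \<Longrightarrow> (\<And>x. x \<in> V \<Longrightarrow> f x = g x) \<Longrightarrow> f = g"
  by (auto simp: End_monoid_carrier_iff PiE_iff intro: extensionalityI[of _ V])

lemma mult_apply: "x \<in> V \<Longrightarrow> (f \<otimes>\<^bsub>M\<^esub> g) x = g (f x)"
  by (simp add: End_monoid_mult compose_def)

text \<open>If \<open>f = u \<otimes> g\<close>, then \<open>u\<close> takes edges to edges, so
  every image edge under \<open>f\<close> is one under \<open>g\<close>. The two factorisations of
  an \<L>-related pair give both inclusions.\<close>

lemma green_L_image:
  assumes "(f, g) \<in> green_L M"
  shows "f ` V = g ` V" "image_edges E f = image_edges E g"
proof -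
  have sub: "f ` V \<subseteq> g ` V \<and> image_edges E f \<subseteq> image_edges E g"
    if "u \<in> carrier M" "f = u \<otimes>\<^bsub>M\<^esub> g" for f g u
  proof
    show "f ` V \<subseteq> g ` V" using that by (auto simp: mult_apply M_mem)
    show "image_edges E f \<subseteq> image_edges E g"
    proof (rule subrelI)
      fix a b assume "(a, b) \<in> image_edges E f"
      then obtain x y where xy: "(x, y) \<in> E" "a = f x" "b = f y" by (auto simp: image_edges_iff)
      moreover have "x \<in> V" "y \<in> V" using xy E_sub by auto
      ultimately show "(a, b) \<in> image_edges E g"
        using that M_edge[OF that(1) xy(1)] by (auto simp: image_edges_iff mult_apply)
    qed
  qed
  show "f ` V = g ` V" "image_edges E f = image_edges E g"
    using assms sub unfolding M.green_L_iff by blast+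
qed

text \<open>On the images, \<open>v\<close> sends \<open>f x\<close> to \<open>g x\<close> and
  \<open>u\<close> sends it back, so both carry the image of an edge to the image of the same
  edge.\<close>

lemma green_R_image_iso:
  assumes uv: "f \<in> carrier M" "v \<in> carrier M" "u \<in> carrier M" "g = f \<otimes>\<^bsub>M\<^esub> v" "f = g \<otimes>\<^bsub>M\<^esub> u"
  shows "digraph_iso (f ` V) (image_edges E f) (g ` V) (image_edges E g) v"
proof -
  have vf: "v (f x) = g x" if "x \<in> V" for x using that by (simp add: uv(4) mult_apply)
  have ug: "u (g x) = f x" if "x \<in> V" for x using that arg_cong[OF uv(5), of "\<lambda>h. h x"] by (simp add: mult_apply)
  have "inj_on v (f ` V)" using vf ug by (intro inj_on_inverseI[of _ u]) auto
  moreover have "v ` f ` V = g ` V" using vf by (auto simp: image_image)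
  moreover have "(a, b) \<in> image_edges E f \<longleftrightarrow> (v a, v b) \<in> image_edges E g"
    if "a \<in> f ` V" "b \<in> f ` V" for a b
  proof
    assume "(a, b) \<in> image_edges E f"
    then obtain x y where "(x, y) \<in> E" "a = f x" "b = f y" by (auto simp: image_edges_iff)
    then show "(v a, v b) \<in> image_edges E g" using vf E_sub by (auto simp: image_edges_iff)
  next
    assume "(v a, v b) \<in> image_edges E g"
    then obtain x y where xy: "(x, y) \<in> E" "v a = g x" "v b = g y" by (auto simp: image_edges_iff)
    have "x \<in> V" "y \<in> V" using xy E_sub by auto
    moreover have "u (v a) = a" "u (v b) = b" using that vf ug by auto
    ultimately have "a = f x" "b = f y" using xy ug by metis+
    then show "(a, b) \<in> image_edges E f" using xy(1) by (auto simp: image_edges_iff)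
  qed
  ultimately show ?thesis by (simp add: digraph_iso_def bij_betw_def)
qed

lemma green_D_image_iso:
  assumes "(f, g) \<in> green_D M"
  obtains v where "digraph_iso (f ` V) (image_edges E f) (g ` V) (image_edges E g) v"
proof -
  obtain h where h: "(f, h) \<in> green_L M" "(h, g) \<in> green_R M"
    using assms by (auto simp: green_D_def)
  obtain u v where "h \<in> carrier M" "v \<in> carrier M" "u \<in> carrier M" "g = h \<otimes>\<^bsub>M\<^esub> v" "h = g \<otimes>\<^bsub>M\<^esub> u"
    using h(2) unfolding M.green_R_iff by blast
  then show thesis using that green_R_image_iso green_L_image[OF h(1)] by metis
qed

lemma regular_element_green_D:
  assumes "(f, g) \<in> green_D M" "regular_element M g"
  shows "regular_element M f"
proof -
  obtain h where h: "(f, h) \<in> green_L M" "(h, g) \<in> green_R M"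
    using assms(1) by (auto simp: green_D_def)
  show ?thesis
    using M.regular_element_green_L[OF h(1) M.regular_element_green_R[OF h(2) assms(2)]] .
qed

text \<open>An inner inverse \<open>k\<close> is a section of \<open>f\<close> over its image:
  \<open>f (k c) = c\<close>. Hence \<open>(a, b)\<close> is the image of the edge
  \<open>(k a, k b)\<close>.\<close>

lemma regular_element_image_edges:
  assumes "f \<in> carrier M" "regular_element M f" "a \<in> f ` V" "b \<in> f ` V" "(a, b) \<in> E"
  shows "(a, b) \<in> image_edges E f"
proof -
  obtain k where k: "k \<in> carrier M" "f \<otimes>\<^bsub>M\<^esub> k \<otimes>\<^bsub>M\<^esub> f = f"
    using assms(2) by (auto simp: regular_element_def)
  have "f (k c) = c" if c: "c \<in> f ` V" for c
  proof -
    obtain x where "x \<in> V" "c = f x" using c by blast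
    then show ?thesis using arg_cong[OF k(2), of "\<lambda>h. h x"] by (simp add: mult_apply)
  qed
  then have "f (k a) = a" "f (k b) = b" using assms by auto
  then show ?thesis using M_edge[OF k(1) assms(5)] unfolding image_edges_iff by metis
qed

section \<open>Transport of extensions and lifts along Green's relations\<close>

text \<open>The image digraph is unchanged, so the extension \<open>t\<close> is kept. Only the lift
  changes, to \<open>v \<otimes> s \<otimes> u\<close>, because \<open>f\<close> and
  \<open>g\<close> differ by left factors.\<close>

lemma auts_extend_and_lift_green_L:
  assumes fg: "(f, g) \<in> green_L M" and f: "auts_extend_and_lift V E f"
  shows "auts_extend_and_lift V E g"
  unfolding auts_extend_and_lift_def
proof (intro allI impI)
  fix a assume "digraph_iso (g ` V) (image_edges E g) (g ` V) (image_edges E g) a"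
  then have "digraph_iso (f ` V) (image_edges E f) (f ` V) (image_edges E f) a"
    by (simp only: green_L_image[OF fg])
  then obtain t s where ts: "t \<in> carrier M" "s \<in> carrier M"
    "\<forall>x\<in>V. t (f x) = a (f x)" "\<forall>x\<in>V. f (s x) = a (f x)"
    by (rule auts_extend_and_liftD[OF f])
  note ts = ts(1,2) ts(3,4)[rule_format]
  obtain u v where uv: "u \<in> carrier M" "v \<in> carrier M" "f = u \<otimes>\<^bsub>M\<^esub> g" "g = v \<otimes>\<^bsub>M\<^esub> f"
    using fg unfolding M.green_L_iff by blast
  have fu: "f x = g (u x)" if "x \<in> V" for x using that by (simp add: uv(3) mult_apply)
  have gv: "g x = f (v x)" if "x \<in> V" for x
    using that arg_cong[OF uv(4), of "\<lambda>h. h x"] by (simp add: mult_apply)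
  have "t (g x) = a (g x) \<and> g ((v \<otimes>\<^bsub>M\<^esub> s \<otimes>\<^bsub>M\<^esub> u) x) = a (g x)" if x: "x \<in> V" for x
  proof
    have V: "v x \<in> V" "s (v x) \<in> V" using x uv(2) ts(2) by (simp_all add: M_mem)
    show "t (g x) = a (g x)" using gv[OF x] ts(3)[OF V(1)] by simp
    show "g ((v \<otimes>\<^bsub>M\<^esub> s \<otimes>\<^bsub>M\<^esub> u) x) = a (g x)"
      using gv[OF x] ts(4)[OF V(1)] fu[OF V(2)] x by (simp add: mult_apply)
  qed
  then show "\<exists>t\<in>carrier M. \<exists>s\<in>carrier M. \<forall>x\<in>V. t (g x) = a (g x) \<and> g (s x) = a (g x)"
    using ts(1,2) uv(1,2) by (intro bexI[of _ t] bexI[of _ "v \<otimes>\<^bsub>M\<^esub> s \<otimes>\<^bsub>M\<^esub> u"]) simp_all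
qed

text \<open>The roles are exchanged: \<open>u\<close> and \<open>v\<close> identify the two image
  digraphs, so \<open>a\<close> is conjugated to an automorphism of the image of \<open>f\<close>.
  The lift \<open>s\<close> is kept and the extension becomes
  \<open>u \<otimes> t \<otimes> v\<close>.\<close>

lemma auts_extend_and_lift_green_R:
  assumes fg: "(f, g) \<in> green_R M" and f: "auts_extend_and_lift V E f"
  shows "auts_extend_and_lift V E g"
  unfolding auts_extend_and_lift_def
proof (intro allI impI)
  fix a assume a: "digraph_iso (g ` V) (image_edges E g) (g ` V) (image_edges E g) a"
  obtain u v where uv: "f \<in> carrier M" "g \<in> carrier M" "u \<in> carrier M" "v \<in> carrier M"
    "f = g \<otimes>\<^bsub>M\<^esub> u" "g = f \<otimes>\<^bsub>M\<^esub> v"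
    using fg unfolding M.green_R_iff by blast
  have fu: "f x = u (g x)" if "x \<in> V" for x using that by (simp add: uv(5) mult_apply)
  have gv: "g x = v (f x)" if "x \<in> V" for x
    using that arg_cong[OF uv(6), of "\<lambda>h. h x"] by (simp add: mult_apply)
  have "digraph_iso (f ` V) (image_edges E f) (f ` V) (image_edges E f) (u \<circ> (a \<circ> v))"
    using digraph_iso_compose[OF digraph_iso_compose[OF green_R_image_iso[OF uv(1,4,3,6,5)] a]
        green_R_image_iso[OF uv(2,3,4,5,6)]] .
  then obtain t s where ts: "t \<in> carrier M" "s \<in> carrier M"
    "\<forall>x\<in>V. t (f x) = (u \<circ> (a \<circ> v)) (f x)" "\<forall>x\<in>V. f (s x) = (u \<circ> (a \<circ> v)) (f x)"
    by (rule auts_extend_and_liftD[OF f])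
  note ts = ts(1,2) ts(3,4)[rule_format, unfolded comp_def]
  have "(u \<otimes>\<^bsub>M\<^esub> t \<otimes>\<^bsub>M\<^esub> v) (g x) = a (g x) \<and> g (s x) = a (g x)" if x: "x \<in> V" for x
  proof
    have gx: "g x \<in> V" using x uv(2) by (simp add: M_mem)
    have "a (g x) \<in> g ` V" using digraph_iso_mem[OF a] x by blast
    then obtain y where y: "y \<in> V" "a (g x) = g y" by blast
    \<comment> \<open>The map \<open>v\<close> is known to undo \<open>u\<close> on the image of
      \<open>g\<close>, which is why the value of \<open>a\<close> was first written as
      \<open>g y\<close>.\<close>
    then have vu: "v (u (a (g x))) = a (g x)" using fu[OF y(1), symmetric] gv[OF y(1), symmetric] by simp
    show "(u \<otimes>\<^bsub>M\<^esub> t \<otimes>\<^bsub>M\<^esub> v) (g x) = a (g x)"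
      using gx ts(3)[OF x] fu[OF x, symmetric] gv[OF x, symmetric] vu by (simp add: mult_apply)
    have "s x \<in> V" using x ts(2) by (simp add: M_mem)
    then show "g (s x) = a (g x)" using gv[of "s x"] ts(4)[OF x] gv[OF x, symmetric] vu by simp
  qed
  then show "\<exists>t\<in>carrier M. \<exists>s\<in>carrier M. \<forall>x\<in>V. t (g x) = a (g x) \<and> g (s x) = a (g x)"
    using ts(1,2) uv(3,4) by (intro bexI[of _ "u \<otimes>\<^bsub>M\<^esub> t \<otimes>\<^bsub>M\<^esub> v"] bexI[of _ s]) simp_all
qed

lemma auts_extend_and_lift_green_D:
  assumes "(f, g) \<in> green_D M" "auts_extend_and_lift V E f"
  shows "auts_extend_and_lift V E g"
proof -
  obtain h where h: "(f, h) \<in> green_L M" "(h, g) \<in> green_R M"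
    using assms(1) by (auto simp: green_D_def)
  show ?thesis
    using auts_extend_and_lift_green_R[OF h(2) auts_extend_and_lift_green_L[OF h(1) assms(2)]] .
qed

section \<open>The Schuetzenberger group of an \<H>-class\<close>

lemma green_H_image:
  assumes "(f, h) \<in> green_H M"
  shows "h ` V = f ` V" "image_edges E h = image_edges E f"
  using assms green_L_image[of f h] by (auto simp: green_H_def)

text \<open>Extension and lift give \<open>f \<otimes> t = s \<otimes> f\<close>. The extension
  \<open>t'\<close> and lift \<open>s'\<close> of the inverse automorphism undo this on either side,
  so \<open>f \<otimes> t\<close> is \<H>-related to \<open>f\<close>. Writing
  \<open>h = v \<otimes> f\<close> carries this over to every \<open>h\<close> in the class.\<close>

lemma aut_acts_on_green_H:
  assumes good: "auts_extend_and_lift V E f" and f: "f \<in> carrier M"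
    and a: "digraph_iso (f ` V) (image_edges E f) (f ` V) (image_edges E f) a"
  obtains t where "t \<in> carrier M" "\<And>x. x \<in> V \<Longrightarrow> t (f x) = a (f x)"
    "\<And>h. (f, h) \<in> green_H M \<Longrightarrow> (f, h \<otimes>\<^bsub>M\<^esub> t) \<in> green_H M"
proof -
  obtain t s where ts: "t \<in> carrier M" "s \<in> carrier M"
    "\<forall>x\<in>V. t (f x) = a (f x)" "\<forall>x\<in>V. f (s x) = a (f x)"
    by (rule auts_extend_and_liftD[OF good a])
  note ts = ts(1,2) ts(3,4)[rule_format]
  define b where "b = inv_into (f ` V) a"
  have b: "digraph_iso (f ` V) (image_edges E f) (f ` V) (image_edges E f) b"
    unfolding b_def by (rule digraph_iso_inv_into[OF a])
  obtain t' s' where ts': "t' \<in> carrier M" "s' \<in> carrier M"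
    "\<forall>x\<in>V. t' (f x) = b (f x)" "\<forall>x\<in>V. f (s' x) = b (f x)"
    by (rule auts_extend_and_liftD[OF good b])
  note ts' = ts'(1,2) ts'(3,4)[rule_format]
  have ab: "a (b y) = y" "b (a y) = y" if "y \<in> f ` V" for y
    using a that by (auto simp: digraph_iso_def b_def bij_betw_def f_inv_into_f)
  have clo: "a y \<in> f ` V" "b y \<in> f ` V" if "y \<in> f ` V" for y
    using digraph_iso_mem[OF a that] digraph_iso_mem[OF b that] by auto
  have tf: "f \<otimes>\<^bsub>M\<^esub> t = s \<otimes>\<^bsub>M\<^esub> f"
    using f ts by (intro M_ext) (simp_all add: mult_apply)
  have tt': "f \<otimes>\<^bsub>M\<^esub> t \<otimes>\<^bsub>M\<^esub> t' = f"
  proof (rule M_ext)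
    fix x assume x: "x \<in> V"
    obtain y where y: "y \<in> V" "a (f x) = f y" using clo(1)[of "f x"] x by blast
    have "t' (a (f x)) = b (a (f x))" using ts'(3)[OF y(1)] y(2) by simp
    then show "(f \<otimes>\<^bsub>M\<^esub> t \<otimes>\<^bsub>M\<^esub> t') x = f x"
      using x ts(3)[OF x] ab(2)[of "f x"] by (simp add: mult_apply)
  qed (use f ts(1,2) ts'(1,2) in simp_all)
  have s'f: "s' \<otimes>\<^bsub>M\<^esub> (f \<otimes>\<^bsub>M\<^esub> t) = f"
  proof (rule M_ext)
    fix x assume x: "x \<in> V"
    have s'x: "s' x \<in> V" using x ts'(2) by (simp add: M_mem)
    have "t (f (s' x)) = a (b (f x))" using ts(3)[OF s'x] ts'(4)[OF x] by simp
    then show "(s' \<otimes>\<^bsub>M\<^esub> (f \<otimes>\<^bsub>M\<^esub> t)) x = f x"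
      using x s'x ab(1)[of "f x"] by (simp add: mult_apply)
  qed (use f ts(1,2) ts'(1,2) in simp_all)
  have "(f, h \<otimes>\<^bsub>M\<^esub> t) \<in> green_H M" if h: "(f, h) \<in> green_H M" for h
  proof -
    obtain u v where uv: "h \<in> carrier M" "u \<in> carrier M" "v \<in> carrier M"
      "f = u \<otimes>\<^bsub>M\<^esub> h" "h = v \<otimes>\<^bsub>M\<^esub> f"
      using h unfolding green_H_def Int_iff M.green_L_iff by blast
    obtain w z where wz: "w \<in> carrier M" "z \<in> carrier M" "f = h \<otimes>\<^bsub>M\<^esub> w" "h = f \<otimes>\<^bsub>M\<^esub> z"
      using h unfolding green_H_def Int_iff M.green_R_iff by blast
    have ht: "h \<otimes>\<^bsub>M\<^esub> t = v \<otimes>\<^bsub>M\<^esub> (f \<otimes>\<^bsub>M\<^esub> t)"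
      using M.m_assoc[OF uv(3) f ts(1)] uv(5) by simp
    have "h \<otimes>\<^bsub>M\<^esub> t = (v \<otimes>\<^bsub>M\<^esub> s) \<otimes>\<^bsub>M\<^esub> f"
      unfolding ht tf using uv(1-3) f ts(1,2) by (simp add: M.m_assoc)
    moreover have "f = (s' \<otimes>\<^bsub>M\<^esub> u) \<otimes>\<^bsub>M\<^esub> (h \<otimes>\<^bsub>M\<^esub> t)"
    proof -
      have "(s' \<otimes>\<^bsub>M\<^esub> u) \<otimes>\<^bsub>M\<^esub> (h \<otimes>\<^bsub>M\<^esub> t) = s' \<otimes>\<^bsub>M\<^esub> ((u \<otimes>\<^bsub>M\<^esub> h) \<otimes>\<^bsub>M\<^esub> t)"
        using uv(1-3) ts(1) ts'(2) by (simp add: M.m_assoc)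
      then show ?thesis using s'f unfolding uv(4)[symmetric] by simp
    qed
    moreover have "v \<otimes>\<^bsub>M\<^esub> s \<in> carrier M" "s' \<otimes>\<^bsub>M\<^esub> u \<in> carrier M" "h \<otimes>\<^bsub>M\<^esub> t \<in> carrier M"
      using uv(1-3) ts(1,2) ts'(1,2) by simp_all
    ultimately have L: "(f, h \<otimes>\<^bsub>M\<^esub> t) \<in> green_L M"
      unfolding M.green_L_iff using f by blast
    have "h \<otimes>\<^bsub>M\<^esub> t \<otimes>\<^bsub>M\<^esub> t' = v \<otimes>\<^bsub>M\<^esub> (f \<otimes>\<^bsub>M\<^esub> t \<otimes>\<^bsub>M\<^esub> t')"
      unfolding ht using uv(1-3) f ts(1) ts'(1) by (simp add: M.m_assoc)
    also have "\<dots> = h" unfolding tt' using uv(5) by simp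
    finally have "h \<otimes>\<^bsub>M\<^esub> t \<otimes>\<^bsub>M\<^esub> t' = h" .
    then have "f = (h \<otimes>\<^bsub>M\<^esub> t) \<otimes>\<^bsub>M\<^esub> (t' \<otimes>\<^bsub>M\<^esub> w)"
      using wz(3) uv(1) ts(1) ts'(1) wz(1) by (metis M.m_assoc M.m_closed)
    moreover have "h \<otimes>\<^bsub>M\<^esub> t = f \<otimes>\<^bsub>M\<^esub> (z \<otimes>\<^bsub>M\<^esub> t)"
      using M.m_assoc[OF f wz(2) ts(1)] wz(4) by simp
    moreover have "t' \<otimes>\<^bsub>M\<^esub> w \<in> carrier M" "z \<otimes>\<^bsub>M\<^esub> t \<in> carrier M" using wz(1,2) ts(1) ts'(1) by simp_all
    ultimately have "(f, h \<otimes>\<^bsub>M\<^esub> t) \<in> green_R M"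
      unfolding M.green_R_iff using f uv(1) ts(1) by blast
    then show ?thesis using L by (simp add: green_H_def)
  qed
  then show thesis using that ts by blast
qed

text \<open>All members of the class have the same image, so a right translation by \<open>t\<close>
  depends only on the restriction of \<open>t\<close> to it. For \<open>t\<close> in the stabiliser
  this restriction is an automorphism of the image digraph, and by assumption every automorphism
  arises so.\<close>

lemma schuetzenberger_group_iso_Aut:
  assumes good: "auts_extend_and_lift V E f" and f: "f \<in> carrier M"
  shows "Aut_group (f ` V) (image_edges E f) \<cong> schuetzenberger_group M (green_H M `` {f})"
    (is "?A \<cong> schuetzenberger_group M ?H")
proof -
  define \<Phi> where "\<Phi> = (\<lambda>a :: 'v \<Rightarrow> 'v. \<lambda>h\<in>?H. compose V a h)"
  have fH: "f \<in> ?H" using f by (auto simp: green_H_def green_L_def green_R_def)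
  have HV: "h x \<in> f ` V" if "h \<in> ?H" "x \<in> V" for h x
    using that green_H_image(1)[of f h] by auto
  have trans: "right_translation M ?H t = \<Phi> a" if "\<And>x. x \<in> V \<Longrightarrow> t (f x) = a (f x)" for t a
  proof -
    have "t y = a y" if "y \<in> f ` V" for y using that \<open>\<And>x. x \<in> V \<Longrightarrow> t (f x) = a (f x)\<close> by auto
    then show ?thesis
      unfolding right_translation_def \<Phi>_def End_monoid_mult compose_def
      using HV by (intro restrict_ext) (simp cong: restrict_cong)
  qed
  have act: "\<Phi> a \<in> carrier (schuetzenberger_group M ?H) \<and> (\<forall>h\<in>?H. \<Phi> a h \<in> ?H)"
    if a: "a \<in> carrier ?A" for a
  proof -
    obtain t where t: "t \<in> carrier M" "\<And>x. x \<in> V \<Longrightarrow> t (f x) = a (f x)"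
      "\<And>h. (f, h) \<in> green_H M \<Longrightarrow> (f, h \<otimes>\<^bsub>M\<^esub> t) \<in> green_H M"
      using aut_acts_on_green_H[OF good f] a unfolding Aut_group_carrier_iff by blast
    have t': "t \<in> right_stabiliser M ?H"
      using t(1,3) by (auto simp: right_stabiliser_def r_coset_def)
    have tr: "right_translation M ?H t = \<Phi> a" by (rule trans) (rule t(2))
    have "\<Phi> a h \<in> ?H" if "h \<in> ?H" for h
      unfolding tr[symmetric] using that t(3) by (simp add: right_translation_def)
    moreover have "\<Phi> a \<in> carrier (schuetzenberger_group M ?H)"
      unfolding tr[symmetric] schuetzenberger_group_def using t' by simp
    ultimately show ?thesis by blast
  qed
  have surj: "c \<in> \<Phi> ` carrier ?A" if c: "c \<in> carrier (schuetzenberger_group M ?H)" for c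
  proof -
    obtain t where t: "t \<in> carrier M" "?H #>\<^bsub>M\<^esub> t \<subseteq> ?H" "c = right_translation M ?H t"
      using c by (auto simp: schuetzenberger_group_def right_stabiliser_def)
    \<comment> \<open>The \<R>-part makes \<open>t\<close> an isomorphism between the image digraphs
      of \<open>f\<close> and \<open>f \<otimes> t\<close>; by the \<L>-part these two
      coincide.\<close>
    have ft: "(f, f \<otimes>\<^bsub>M\<^esub> t) \<in> green_H M" using t(2) fH by (auto simp: r_coset_def)
    then obtain u where u: "u \<in> carrier M" "f = (f \<otimes>\<^bsub>M\<^esub> t) \<otimes>\<^bsub>M\<^esub> u"
      unfolding green_H_def Int_iff M.green_R_iff by blast
    have "digraph_iso (f ` V) (image_edges E f) (f ` V) (image_edges E f) t"
      using green_R_image_iso[OF f t(1) u(1) refl u(2)] unfolding green_H_image[OF ft] .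
    then have "restrict t (f ` V) \<in> carrier ?A" by (rule Aut_group_restrict)
    moreover have "c = \<Phi> (restrict t (f ` V))" unfolding t(3) by (rule trans) simp
    ultimately show ?thesis by blast
  qed
  have "inj_on \<Phi> (carrier ?A)"
  proof (rule inj_onI)
    fix a b assume ab: "a \<in> carrier ?A" "b \<in> carrier ?A" "\<Phi> a = \<Phi> b"
    have "compose V a f = compose V b f" using fun_cong[OF ab(3), of f] fH by (simp add: \<Phi>_def)
    then have "a (f x) = b (f x)" if "x \<in> V" for x
      using that by (metis compose_eq)
    then show "a = b"
      using ab(1,2) by (auto simp: Aut_group_carrier_iff intro: extensionalityI[of _ "f ` V"])
  qed
  then have "bij_betw \<Phi> (carrier ?A) (carrier (schuetzenberger_group M ?H))"
    using act surj by (auto simp: bij_betw_def)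
  moreover have "\<Phi> \<in> hom ?A (schuetzenberger_group M ?H)"
  proof (rule homI)
    fix a b assume a: "a \<in> carrier ?A" and "b \<in> carrier ?A"
    have "\<Phi> (compose (f ` V) b a) h = compose ?H (\<Phi> b) (\<Phi> a) h" for h
    proof (cases "h \<in> ?H")
      case True
      then have "\<Phi> a h \<in> ?H" using act[OF a] by blast
      then show ?thesis
        using True HV[OF True] by (auto simp: compose_def \<Phi>_def)
    qed (simp add: compose_def \<Phi>_def)
    then show "\<Phi> (a \<otimes>\<^bsub>?A\<^esub> b) = \<Phi> a \<otimes>\<^bsub>schuetzenberger_group M ?H\<^esub> \<Phi> b"
      by (auto simp: Aut_group_mult schuetzenberger_group_def)
  qed (use act in blast)
  ultimately have "\<Phi> \<in> iso ?A (schuetzenberger_group M ?H)" by (simp add: iso_def)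
  then show ?thesis by (auto simp: is_iso_def)
qed

end

section \<open>Realising a digraph as an image digraph\<close>

text \<open>The missing edge from \<open>u0\<close> to \<open>v0\<close> ensures non-regularity: its
  endpoints are mapped to distinct vertices of a clique, which are joined in \<open>E\<close> but
  not by an image edge.\<close>

lemma realise_image_digraph:
  assumes univ: "universal_digraph V E" and U: "is_digraph U J" "countable U" "infinite U"
    and closed: "\<And>S. finite S \<Longrightarrow> S \<subseteq> U \<Longrightarrow> \<exists>u\<in>U. \<forall>s\<in>S. (u, s) \<in> J \<and> (s, u) \<in> J"
    and non_edge: "u0 \<in> U" "v0 \<in> U" "u0 \<noteq> v0" "(u0, v0) \<notin> J"
  obtains f \<beta> where "f \<in> carrier (End_monoid V E)" "\<not> regular_element (End_monoid V E) f"
    "auts_extend_and_lift V E f" "digraph_iso U J (f ` V) (image_edges E f) \<beta>"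
proof -
  have VE: "is_digraph V E" "E \<subseteq> V \<times> V"
    using univ by (auto simp: universal_digraph_def is_digraph_def)
  interpret digraph V E by unfold_locales (rule VE(1))
  obtain x :: "nat \<Rightarrow> _" where x: "inj x" "range x \<subseteq> V" "\<And>m n. m \<noteq> n \<Longrightarrow> (x m, x n) \<in> E"
    "\<And>v. v \<in> V - range x \<Longrightarrow> finite {y \<in> range x. (v, y) \<in> E \<or> (y, v) \<in> E}"
    using universal_digraph_clique[OF univ] by blast
  \<comment> \<open>As \<open>U\<close> is countably infinite, its enumeration followed by that of
    the clique is a bijection onto the clique.\<close>
  define \<beta> where "\<beta> = (\<lambda>u. x (to_nat_on U u))"
  have "bij_betw (x \<circ> to_nat_on U) U (range x)"
    using to_nat_on_infinite[OF U(2,3)] x(1)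
    by (rule bij_betw_trans[OF _ inj_on_imp_bij_betw])
  then have \<beta>: "bij_betw \<beta> U (range x)" by (simp add: \<beta>_def comp_def)
  have clique: "(y, z) \<in> E" if "y \<in> range x" "z \<in> range x" "y \<noteq> z" for y z
  proof -
    obtain m n where "y = x m" "z = x n" using \<open>y \<in> range x\<close> \<open>z \<in> range x\<close> by blast
    then show ?thesis using x(3)[of m n] \<open>y \<noteq> z\<close> by auto
  qed
  have \<beta>X: "\<beta> u \<in> range x" for u by (simp add: \<beta>_def)
  have \<beta>inj: "\<beta> u = \<beta> v \<longleftrightarrow> u = v" if "u \<in> U" "v \<in> U" for u v
    using \<beta> that by (auto simp: bij_betw_def inj_on_def)
  have J: "J \<subseteq> U \<times> U" "\<And>u. (u, u) \<notin> J" using U(1) by (auto simp: is_digraph_def irrefl_def)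
  have "U \<noteq> {}" using U(3) by auto
  then obtain p where p: "p \<in> V \<rightarrow> U" "\<And>x y. (x, y) \<in> E \<Longrightarrow> (p x, p y) \<in> J"
    and gen: "generic_map V E U J p"
    using generic_hom[OF univ U(2) _ closed] by blast
  have pU: "p v \<in> U" if "v \<in> V" for v using p(1) that by auto
  define f where "f = (\<lambda>v\<in>V. \<beta> (p v))"
  have surj: "\<exists>z\<in>V. p z = u" if "u \<in> U" for u using generic_mapD[OF gen that, of "{}" "{}"] by blast
  have fV: "f ` V = range x"
  proof
    show "f ` V \<subseteq> range x" using \<beta>X by (auto simp: f_def)
    show "range x \<subseteq> f ` V"
    proof
      fix y assume "y \<in> range x"
      then obtain u where u: "u \<in> U" "y = \<beta> u" using \<beta> by (auto simp: bij_betw_def)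
      then obtain z where "z \<in> V" "p z = u" using surj by blast
      then show "y \<in> f ` V" using u(2) by (auto simp: f_def)
    qed
  qed
  have f: "f \<in> carrier M"
    unfolding End_monoid_carrier_iff
  proof (intro conjI allI impI)
    show "f \<in> V \<rightarrow>\<^sub>E V" using \<beta>X x(2) by (auto simp: f_def)
    fix v w assume vw: "(v, w) \<in> E"
    then have V: "v \<in> V" "w \<in> V" using VE(2) by auto
    have "p v \<noteq> p w" using p(2)[OF vw] J(2) by metis
    then have "\<beta> (p v) \<noteq> \<beta> (p w)" using \<beta>inj pU V by simp
    then show "(f v, f w) \<in> E" using clique \<beta>X V by (simp add: f_def)
  qed
  have edges: "(u, v) \<in> J \<longleftrightarrow> (\<beta> u, \<beta> v) \<in> image_edges E f" if uv: "u \<in> U" "v \<in> U" for u v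
  proof
    assume J: "(u, v) \<in> J"
    obtain y where y: "y \<in> V" "p y = u" using surj[OF uv(1)] by blast
    \<comment> \<open>Genericity lifts the edge from \<open>u\<close> to \<open>v\<close> to an edge
      of \<open>E\<close> starting at the preimage \<open>y\<close>; thus no edge of
      \<open>J\<close> is lost.\<close>
    obtain z where z: "z \<in> V" "p z = v" "(y, z) \<in> E"
      using generic_mapD[OF gen uv(2), of "{y}" "{}"] y J by auto
    have "\<beta> u = f y" "\<beta> v = f z" using y z by (simp_all add: f_def)
    then show "(\<beta> u, \<beta> v) \<in> image_edges E f" using z(3) unfolding image_edges_iff by blast
  next
    assume "(\<beta> u, \<beta> v) \<in> image_edges E f"
    then obtain y z where yz: "(y, z) \<in> E" "\<beta> u = f y" "\<beta> v = f z" by (auto simp: image_edges_iff)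
    then have "y \<in> V" "z \<in> V" using VE(2) by auto
    then have "u = p y" "v = p z" using yz \<beta>inj uv pU by (simp_all add: f_def)
    then show "(u, v) \<in> J" using p(2) yz(1) by simp
  qed
  have iso: "digraph_iso U J (f ` V) (image_edges E f) \<beta>"
    unfolding digraph_iso_def fV using \<beta> edges by blast
  have "\<not> regular_element M f"
  proof
    assume reg: "regular_element M f"
    have "(\<beta> u0, \<beta> v0) \<in> E" using clique \<beta>X \<beta>inj non_edge by simp
    then have "(\<beta> u0, \<beta> v0) \<in> image_edges E f"
      using regular_element_image_edges[OF f reg] fV \<beta>X by simp
    then show False using edges non_edge by simp
  qed
  moreover have "auts_extend_and_lift V E f"
    unfolding auts_extend_and_lift_def
  proof (intro allI impI)
    fix a assume a: "digraph_iso (f ` V) (image_edges E f) (f ` V) (image_edges E f) a"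
    have "inj_on a (range x)" "a ` range x \<subseteq> range x"
      using a by (auto simp: fV digraph_iso_def bij_betw_def)
    then obtain t where t: "t \<in> carrier M" "\<And>y. y \<in> range x \<Longrightarrow> t y = a y"
      using clique_map_extends[OF univ x(2) clique x(4)] by metis
    \<comment> \<open>The automorphism \<open>a\<close> pulled back to \<open>U\<close>, where the
      generic map \<open>p\<close> can lift it. The extension \<open>t\<close> comes from the clique
      instead.\<close>
    define c where "c = inv_into U \<beta> \<circ> (a \<circ> \<beta>)"
    have c: "digraph_iso U J U J c"
      unfolding c_def
      by (rule digraph_iso_compose[OF digraph_iso_compose[OF iso a] digraph_iso_inv_into[OF iso]])
    have cU: "c \<in> U \<rightarrow> U" using digraph_iso_mem[OF c] by auto
    have cJ: "(c u, c v) \<in> J" if "(u, v) \<in> J" for u v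
      using that c J(1) unfolding digraph_iso_def by blast
    obtain s where s: "s \<in> carrier M" "\<And>v. v \<in> V \<Longrightarrow> p (s v) = c (p v)"
      by (rule generic_hom_lift[OF univ p(1) p(2) gen cU cJ]) blast+
    have "t (f v) = a (f v) \<and> f (s v) = a (f v)" if v: "v \<in> V" for v
    proof
      have fv: "f v \<in> range x" using fV v by blast
      show "t (f v) = a (f v)" using t(2)[OF fv] .
      have "a (f v) \<in> \<beta> ` U" using digraph_iso_mem[OF a, of "f v"] v \<beta> fV by (auto simp: bij_betw_def)
      then have "\<beta> (c (p v)) = a (f v)" using v by (simp add: c_def f_def f_inv_into_f)
      then show "f (s v) = a (f v)" using s M_mem[OF s(1) v] v by (simp add: f_def)
    qed
    then show "\<exists>t\<in>carrier M. \<exists>s\<in>carrier M. \<forall>x\<in>V. t (f x) = a (f x) \<and> f (s x) = a (f x)"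
      using t(1) s(1) by blast
  qed
  ultimately show thesis using that f iso by blast
qed

section \<open>Graphs joined with a rigid digraph\<close>

text \<open>The complement of a directed ray with an extra undirected edge between \<^term>\<open>i\<close> and
  \<^term>\<open>i + 2\<close> for each \<^term>\<open>i \<in> S\<close>. Its only asymmetric pairs are the consecutive ones,
  which makes it rigid and lets \<^term>\<open>S\<close> be read off.\<close>

definition ray_complement :: "nat set \<Rightarrow> nat rel" where
  "ray_complement S = {(i, j). i \<noteq> j \<and> j \<noteq> Suc i \<and> \<not> (j = i + 2 \<and> i \<in> S) \<and> \<not> (i = j + 2 \<and> j \<in> S)}"

definition ray_join :: "'a set \<Rightarrow> 'a rel \<Rightarrow> nat set \<Rightarrow> ('a + nat) rel" where
  "ray_join W F S = {(Inl x, Inl y) | x y. (x, y) \<in> F} \<union> {(Inl x, Inr n) | x n. x \<in> W} \<union>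
     {(Inr n, Inl x) | x n. x \<in> W} \<union> {(Inr i, Inr j) | i j. (i, j) \<in> ray_complement S}"

lemma ray_join_iff:
  "(Inl x, Inl y) \<in> ray_join W F S \<longleftrightarrow> (x, y) \<in> F"
  "(Inl x, Inr n) \<in> ray_join W F S \<longleftrightarrow> x \<in> W"
  "(Inr n, Inl x) \<in> ray_join W F S \<longleftrightarrow> x \<in> W"
  "(Inr i, Inr j) \<in> ray_join W F S \<longleftrightarrow> (i, j) \<in> ray_complement S"
  by (auto simp: ray_join_def)

lemma is_digraph_ray_join:
  assumes "is_digraph W F"
  shows "is_digraph (W <+> UNIV) (ray_join W F S)"
  using assms by (auto simp: is_digraph_def ray_join_def irrefl_def ray_complement_def)

text \<open>Ray vertices are joined both ways to all of \<open>W\<close> and to every ray vertex at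
  distance more than 2, so a ray vertex far enough out is a common neighbour.\<close>

lemma ray_join_closed:
  fixes X :: "('a + nat) set"
  assumes X: "finite X" "X \<subseteq> W <+> UNIV"
  shows "\<exists>u\<in>W <+> UNIV. \<forall>s\<in>X. (u, s) \<in> ray_join W F S \<and> (s, u) \<in> ray_join W F S"
proof -
  have "finite (Inr -` X :: nat set)" using X(1) by (intro finite_vimageI) auto
  then obtain N where N: "\<And>n. Inr n \<in> X \<Longrightarrow> n < N"
    unfolding finite_nat_set_iff_bounded by auto
  \<comment> \<open>The offset 3 keeps the distance to every index below \<open>N\<close> larger
    than 2.\<close>
  have "(Inr (N + 3), s) \<in> ray_join W F S \<and> (s, Inr (N + 3)) \<in> ray_join W F S" if s: "s \<in> X" for s
  proof (cases s)
    case (Inl x)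
    then show ?thesis using s X(2) by (auto simp: ray_join_iff)
  next
    case (Inr n)
    then have "n < N" using N s by blast
    then show ?thesis using Inr by (auto simp: ray_join_iff ray_complement_def)
  qed
  then show ?thesis by blast
qed

text \<open>\<open>F\<close> and the edges between \<open>W\<close> and the ray are symmetric, so
  asymmetry can only occur inside the ray. This lets an isomorphism recognise the ray and its
  order.\<close>

lemma ray_join_asymmetric_pair:
  assumes "sym F"
  shows "u \<in> W <+> UNIV \<Longrightarrow> v \<in> W <+> UNIV \<Longrightarrow>
    (u, v) \<notin> ray_join W F S \<and> (v, u) \<in> ray_join W F S \<longleftrightarrow> (\<exists>i. u = Inr i \<and> v = Inr (Suc i))"
  using assms by (cases u; cases v) (auto simp: ray_join_iff ray_complement_def sym_def)

text \<open>Asymmetric pairs go to asymmetric pairs, so \<open>g\<close> shifts the ray by a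
  constant \<open>k\<close>, and \<open>k = 0\<close> because the ray starts at 0. With the ray
  fixed pointwise, the edge between \<open>i\<close> and \<open>i + 2\<close> is absent on either
  side exactly when \<open>i\<close> lies in the respective set.\<close>

lemma ray_join_iso:
  assumes F: "sym F" and g: "digraph_iso (W <+> UNIV) (ray_join W F S) (W <+> UNIV) (ray_join W F T) g"
  shows "g (Inr n) = Inr n" "S = T"
proof -
  let ?U = "W <+> (UNIV :: nat set)"
  have gE: "(u, v) \<in> ray_join W F S \<longleftrightarrow> (g u, g v) \<in> ray_join W F T" if "u \<in> ?U" "v \<in> ?U" for u v
    using g that by (auto simp: digraph_iso_def)
  have pair: "(\<exists>i. u = Inr i \<and> v = Inr (Suc i)) \<longleftrightarrow> (\<exists>i. g u = Inr i \<and> g v = Inr (Suc i))"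
    if uv: "u \<in> ?U" "v \<in> ?U" for u v
    using ray_join_asymmetric_pair[OF F uv, of S] gE[OF uv] gE[OF uv(2,1)]
      ray_join_asymmetric_pair[OF F digraph_iso_mem[OF g uv(1)] digraph_iso_mem[OF g uv(2)], of T]
    by blast
  have step: "\<exists>j. g (Inr i) = Inr j \<and> g (Inr (Suc i)) = Inr (Suc j)" for i
    using pair[of "Inr i" "Inr (Suc i)"] by auto
  obtain k where k: "g (Inr 0) = Inr k" using step by blast
  have shift: "g (Inr i) = Inr (k + i)" for i
  proof (induction i)
    case (Suc i)
    then show ?case using step[of i] by auto
  qed (simp add: k)
  have surj: "g ` ?U = ?U" using g by (auto simp: digraph_iso_def bij_betw_def)
  have "k = 0"
  proof (cases k)
    case (Suc m)
    \<comment> \<open>\<open>Inr m\<close> and \<open>Inr k\<close> are consecutive on the ray, so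
      the preimage of \<open>Inr m\<close> would have to precede \<open>Inr 0\<close>.\<close>
    have "Inr m \<in> g ` ?U" unfolding surj by blast
    then obtain u where u: "u \<in> ?U" "g u = Inr m" by force
    then obtain i where "u = Inr i" "Inr 0 = (Inr (Suc i) :: 'a + nat)"
      using pair[of u "Inr 0"] k Suc by auto
    then show ?thesis by simp
  qed
  then have fix_nat: "g (Inr i) = Inr i" for i using shift by simp
  then show "g (Inr n) = Inr n" .
  have "i \<in> S \<longleftrightarrow> i \<in> T" for i
    using gE[of "Inr i" "Inr (i + 2)"] fix_nat by (auto simp: ray_join_iff ray_complement_def)
  then show "S = T" by blast
qed

text \<open>Automorphisms of the graph extend by the identity on the ray. Conversely, an
  automorphism of the join fixes the ray pointwise, hence maps \<open>W\<close> onto itself and is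
  such an extension.\<close>

lemma Aut_ray_join:
  assumes F: "is_graph W F"
  shows "Aut_group W F \<cong> Aut_group (W <+> UNIV) (ray_join W F S)"
    (is "_ \<cong> Aut_group ?U ?J")
proof -
  have symF: "sym F" using F by (simp add: is_graph_def)
  define \<Phi> where "\<Phi> = (\<lambda>a :: 'a \<Rightarrow> 'a. restrict (map_sum a id) ?U)"
  have mem: "\<Phi> a \<in> carrier (Aut_group ?U ?J)" if a: "a \<in> carrier (Aut_group W F)" for a
    unfolding \<Phi>_def
  proof (rule Aut_group_restrict)
    have a': "bij_betw a W W" "\<And>x y. x \<in> W \<Longrightarrow> y \<in> W \<Longrightarrow> (x, y) \<in> F \<longleftrightarrow> (a x, a y) \<in> F"
      using a by (auto simp: Aut_group_carrier_iff digraph_iso_def)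
    have aW: "a x \<in> W" if "x \<in> W" for x using a'(1) that by (auto simp: bij_betw_def)
    have "inj_on (map_sum a id) ?U"
    proof (rule inj_onI)
      fix u v assume "u \<in> ?U" "v \<in> ?U" "map_sum a id u = map_sum a id v"
      then show "u = v"
        using inj_onD[OF bij_betw_imp_inj_on[OF a'(1)]] by (cases u; cases v) auto
    qed
    moreover have "map_sum a id ` ?U = ?U"
    proof
      show "map_sum a id ` ?U \<subseteq> ?U" using aW by auto
      show "?U \<subseteq> map_sum a id ` ?U"
      proof
        fix u assume u: "u \<in> ?U"
        show "u \<in> map_sum a id ` ?U"
        proof (cases u)
          case (Inl y)
          then obtain x where "x \<in> W" "y = a x" using u bij_betw_imp_surj_on[OF a'(1)] by auto
          then show ?thesis using Inl by (intro image_eqI[of _ _ "Inl x"]) auto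
        next
          case (Inr n)
          then show ?thesis by (intro image_eqI[of _ _ "Inr n"]) auto
        qed
      qed
    qed
    moreover have "(u, v) \<in> ?J \<longleftrightarrow> (map_sum a id u, map_sum a id v) \<in> ?J" if "u \<in> ?U" "v \<in> ?U" for u v
    proof -
      consider x y where "u = Inl x" "v = Inl y" "x \<in> W" "y \<in> W" | x n where "u = Inl x" "v = Inr n" "x \<in> W"
        | x n where "u = Inr n" "v = Inl x" "x \<in> W" | m n where "u = Inr m" "v = Inr n"
        using \<open>u \<in> ?U\<close> \<open>v \<in> ?U\<close> by auto
      then show ?thesis by cases (simp_all add: ray_join_iff a'(2)[symmetric] aW)
    qed
    ultimately show "digraph_iso ?U ?J ?U ?J (map_sum a id)"
      by (simp add: digraph_iso_def bij_betw_def)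
  qed
  have "inj_on \<Phi> (carrier (Aut_group W F))"
  proof (rule inj_onI)
    fix a b assume ab: "a \<in> carrier (Aut_group W F)" "b \<in> carrier (Aut_group W F)" "\<Phi> a = \<Phi> b"
    have "a x = b x" if "x \<in> W" for x
      using fun_cong[OF ab(3), of "Inl x"] that by (simp add: \<Phi>_def InlI)
    then show "a = b" using ab(1,2) by (auto simp: Aut_group_carrier_iff intro: extensionalityI[of _ W])
  qed
  moreover have "g \<in> \<Phi> ` carrier (Aut_group W F)" if g: "g \<in> carrier (Aut_group ?U ?J)" for g
  proof -
    have gi: "digraph_iso ?U ?J ?U ?J g" and gx: "g \<in> extensional ?U"
      using g by (auto simp: Aut_group_carrier_iff)
    have inj: "inj_on g ?U" and surj: "g ` ?U = ?U" using gi by (auto simp: digraph_iso_def bij_betw_def)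
    have g_nat: "g (Inr n) = Inr n" for n by (rule ray_join_iso(1)[OF symF gi])
    \<comment> \<open>For \<open>x \<in> W\<close> the projection is meaningful: each
      \<open>Inr n\<close> is already the value of \<open>g\<close> at \<open>Inr n\<close>, so
      injectivity forces \<open>g (Inl x)\<close> into the left summand.\<close>
    define a where "a = (\<lambda>x. projl (g (Inl x)))"
    have ga: "g (Inl x) = Inl (a x) \<and> a x \<in> W" if x: "x \<in> W" for x
    proof -
      have "g (Inl x) \<noteq> Inr n" for n
      proof
        assume "g (Inl x) = Inr n"
        then have "g (Inl x) = g (Inr n)" using g_nat by simp
        then have "Inl x = (Inr n :: 'a + nat)" by (rule inj_onD[OF inj]) (use x in auto)
        then show False by simp
      qed
      moreover have "g (Inl x) \<in> ?U" using digraph_iso_mem[OF gi] x by blast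
      ultimately show ?thesis by (auto simp: a_def)
    qed
    have "bij_betw a W W"
      unfolding bij_betw_def
    proof
      show "inj_on a W"
      proof (rule inj_onI)
        fix x y assume xy: "x \<in> W" "y \<in> W" "a x = a y"
        then have "g (Inl x) = g (Inl y)" using ga by simp
        then have "Inl x = (Inl y :: 'a + nat)" by (rule inj_onD[OF inj]) (use xy in auto)
        then show "x = y" by simp
      qed
      show "a ` W = W"
      proof
        show "a ` W \<subseteq> W" using ga by blast
        show "W \<subseteq> a ` W"
        proof
          fix y assume "y \<in> W"
          then have "Inl y \<in> g ` ?U" unfolding surj by blast
          then obtain u where u: "u \<in> ?U" "g u = Inl y" by force
          then obtain x where "u = Inl x" "x \<in> W" using g_nat by auto
          then show "y \<in> a ` W" using ga[of x] u(2) by auto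
        qed
      qed
    qed
    moreover have "(x, y) \<in> F \<longleftrightarrow> (a x, a y) \<in> F" if xy: "x \<in> W" "y \<in> W" for x y
    proof -
      have "(Inl x, Inl y) \<in> ?J \<longleftrightarrow> (g (Inl x), g (Inl y)) \<in> ?J"
        using gi xy unfolding digraph_iso_def by blast
      then show ?thesis using ga xy by (simp add: ray_join_iff)
    qed
    ultimately have a: "digraph_iso W F W F a" by (simp add: digraph_iso_def)
    have "\<Phi> (restrict a W) = g"
    proof (rule extensionalityI[of _ ?U])
      fix u assume "u \<in> ?U"
      then show "\<Phi> (restrict a W) u = g u" using ga g_nat by (auto simp: \<Phi>_def)
    qed (use gx in \<open>auto simp: \<Phi>_def\<close>)
    then show ?thesis using Aut_group_restrict[OF a] by blast
  qed
  ultimately have "bij_betw \<Phi> (carrier (Aut_group W F)) (carrier (Aut_group ?U ?J))"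
    using mem by (auto simp: bij_betw_def)
  moreover have "\<Phi> \<in> hom (Aut_group W F) (Aut_group ?U ?J)"
  proof (rule homI)
    fix a b assume a: "a \<in> carrier (Aut_group W F)" and "b \<in> carrier (Aut_group W F)"
    have "\<Phi> (compose W b a) u = compose ?U (\<Phi> b) (\<Phi> a) u" for u
      using a digraph_iso_mem[of W F W F a]
      by (cases "u \<in> ?U") (auto simp: \<Phi>_def compose_def Aut_group_carrier_iff)
    then show "\<Phi> (a \<otimes>\<^bsub>Aut_group W F\<^esub> b) = \<Phi> a \<otimes>\<^bsub>Aut_group ?U ?J\<^esub> \<Phi> b"
      unfolding Aut_group_mult by blast
  qed (rule mem)
  ultimately have "\<Phi> \<in> iso (Aut_group W F) (Aut_group ?U ?J)" by (simp add: iso_def)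
  then show ?thesis by (auto simp: is_iso_def)
qed

section \<open>Counting the classes\<close>

text \<open>An endomorphism is determined by its graph, which is coded as a set of natural numbers
  through an enumeration of \<open>V\<close> and the pairing function.\<close>

lemma End_monoid_lepoll:
  assumes "is_digraph V E" "countable V"
  shows "carrier (End_monoid V E) \<lesssim> (UNIV :: nat set set)"
proof -
  interpret digraph V E by unfold_locales (rule assms(1))
  define e where "e = to_nat_on V"
  have e: "x = y" if "x \<in> V" "y \<in> V" "e x = e y" for x y
    using inj_onD[OF inj_on_to_nat_on[OF assms(2)]] that by (simp add: e_def)
  define c where "c = (\<lambda>f. (\<lambda>x. prod_encode (e x, e (f x))) ` V)"
  have "inj_on c (carrier M)"
  proof (rule inj_onI)
    fix f g assume fg: "f \<in> carrier M" "g \<in> carrier M" "c f = c g"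
    show "f = g"
    proof (rule M_ext[OF fg(1,2)])
      fix x assume x: "x \<in> V"
      then have "prod_encode (e x, e (f x)) \<in> c f" unfolding c_def by blast
      then have "prod_encode (e x, e (f x)) \<in> c g" using fg(3) by simp
      then obtain y where y: "y \<in> V" "e x = e y" "e (f x) = e (g y)"
        by (auto simp: c_def prod_encode_eq)
      then have "x = y" using e x by blast
      then show "f x = g x" using e[OF M_mem[OF fg(1) x] M_mem[OF fg(2) x]] y(3) by simp
    qed
  qed
  then show ?thesis by (auto simp: lepoll_def)
qed

theorem theorem4p10:
  fixes W :: "'a set" and F :: "'a rel" and V :: "'v set" and E :: "'v rel"
  assumes "is_graph W F" and "countable W"
    and "universal_digraph V E"
  shows "{C \<in> carrier (End_monoid V E) // green_D (End_monoid V E).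
            nonregular_class (End_monoid V E) C \<and>
            (\<forall>H \<in> carrier (End_monoid V E) // green_H (End_monoid V E).
               H \<subseteq> C \<longrightarrow> schuetzenberger_group (End_monoid V E) H \<cong> Aut_group W F)}
         \<approx> (UNIV :: nat set set)"
    (is "?Classes \<approx> _")
proof -
  have VE: "is_digraph V E" "countable V" using assms(3) by (auto simp: universal_digraph_def)
  interpret digraph V E by unfold_locales (rule VE(1))
  let ?U = "W <+> (UNIV :: nat set)"
  have symF: "sym F" and dig: "is_digraph W F" using assms(1) by (auto simp: is_graph_def)
  have U: "countable ?U" "infinite ?U"
    using assms(2) by (auto simp: finite_Plus_iff countable_Plus)
  have "\<exists>f \<beta>. f \<in> carrier M \<and> \<not> regular_element M f \<and> auts_extend_and_lift V E f \<and>
      digraph_iso ?U (ray_join W F S) (f ` V) (image_edges E f) \<beta>" for S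
  proof -
    obtain f \<beta> where "f \<in> carrier M" "\<not> regular_element M f" "auts_extend_and_lift V E f"
      "digraph_iso ?U (ray_join W F S) (f ` V) (image_edges E f) \<beta>"
    \<comment> \<open>The missing edge required for non-regularity is the first forward edge of the
      ray, which \<open>ray_complement\<close> omits.\<close>
    proof (rule realise_image_digraph[OF assms(3) is_digraph_ray_join[OF dig] U,
          where ?u0.0 = "Inr 0" and ?v0.0 = "Inr 1"])
      show "\<exists>u\<in>?U. \<forall>s\<in>X. (u, s) \<in> ray_join W F S \<and> (s, u) \<in> ray_join W F S"
        if "finite X" "X \<subseteq> ?U" for X using ray_join_closed[OF that] .
      show "(Inr 0 :: 'a + nat, Inr 1) \<notin> ray_join W F S"
        by (simp add: ray_join_iff ray_complement_def)
    qed auto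
    then show ?thesis by blast
  qed
  then obtain f \<beta> where f: "\<And>S. f S \<in> carrier M" "\<And>S. \<not> regular_element M (f S)"
    "\<And>S. auts_extend_and_lift V E (f S)"
    "\<And>S. digraph_iso ?U (ray_join W F S) (f S ` V) (image_edges E (f S)) (\<beta> S)"
    by metis
  define C where "C = (\<lambda>S. green_D M `` {f S})"
  have D_refl: "(g, g) \<in> green_D M" if "g \<in> carrier M" for g
    using that by (auto simp: green_D_def green_L_def green_R_def)
  have "C S \<in> ?Classes" for S
  proof -
    have "C S \<in> carrier M // green_D M" unfolding C_def by (rule quotientI[OF f(1)])
    moreover have "nonregular_class M (C S)"
      using regular_element_green_D f(2) unfolding nonregular_class_def C_def by blast
    moreover have "schuetzenberger_group M H \<cong> Aut_group W F"
      if H: "H \<in> carrier M // green_H M" "H \<subseteq> C S" for H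
    proof -
      obtain h where h: "h \<in> carrier M" "H = green_H M `` {h}" using H(1) by (rule quotientE)
      have "h \<in> H" using h by (auto simp: green_H_def green_L_def green_R_def)
      \<comment> \<open>The extension and lifting property and the type of the image digraph both
        pass from \<open>f S\<close> to \<open>h\<close>, so the group can be computed at the
        representative \<open>h\<close> of \<open>H\<close>.\<close>
      then have D: "(f S, h) \<in> green_D M" using H(2) by (auto simp: C_def)
      obtain v where v: "digraph_iso (f S ` V) (image_edges E (f S)) (h ` V) (image_edges E h) v"
        using green_D_image_iso[OF D] .
      have "Aut_group W F \<cong> Aut_group ?U (ray_join W F S)" by (rule Aut_ray_join[OF assms(1)])
      also have "\<dots> \<cong> Aut_group (h ` V) (image_edges E h)"
        by (rule Aut_group_iso[OF digraph_iso_compose[OF f(4) v]])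
      also have "\<dots> \<cong> schuetzenberger_group M H"
        unfolding h(2)
        by (rule schuetzenberger_group_iso_Aut[OF auts_extend_and_lift_green_D[OF D f(3)] h(1)])
      finally show ?thesis by (rule group.iso_sym[OF group_Aut_group])
    qed
    ultimately show ?thesis by blast
  qed
  moreover have "inj C"
  proof (rule injI)
    fix S T assume "C S = C T"
    then have D: "(f S, f T) \<in> green_D M" using D_refl[OF f(1), of T] by (auto simp: C_def)
    obtain v where v: "digraph_iso (f S ` V) (image_edges E (f S)) (f T ` V) (image_edges E (f T)) v"
      using green_D_image_iso[OF D] .
    \<comment> \<open>Through the image digraphs of \<open>f S\<close> and \<open>f T\<close>, the
      joins for \<open>S\<close> and \<open>T\<close> become isomorphic, and the ray determines the
      set.\<close>
    show "S = T"
      using ray_join_iso(2)[OF symF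
          digraph_iso_compose[OF digraph_iso_compose[OF f(4) v] digraph_iso_inv_into[OF f(4)]]] .
  qed
  ultimately have "(UNIV :: nat set set) \<lesssim> ?Classes" unfolding lepoll_def by blast
  \<comment> \<open>The upper bound: there are at most as many classes as endomorphisms.\<close>
  moreover have "?Classes \<subseteq> (\<lambda>g. green_D M `` {g}) ` carrier M" by (auto simp: quotient_def)
  then have "?Classes \<lesssim> (UNIV :: nat set set)"
    using subset_imp_lepoll image_lepoll End_monoid_lepoll[OF VE] lepoll_trans by meson
  ultimately show ?thesis by (simp add: lepoll_antisym)
qed

end
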